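(* Let $d \ge 1$ and let $E \subset \partial\mathbb{B}_d$ be a compact set with $\operatorname{cap}_{H^2_d}(E) = 0$. Then there exists $f \in H^2_d$ with $\lim_{r \nearrow 1} |f(r\zeta)| = \infty$ for all $\zeta \in E$.
   Context: $\mathbb{B}_d$ is the open Euclidean unit ball of $\mathbb{C}^d$, with boundary sphere $\partial\mathbb{B}_d$. The Drury--Arveson space $H^2_d$ is the reproducing kernel Hilbert space of holomorphic functions on $\mathbb{B}_d$ with kernel $K(z,w) = \frac{1}{1 - \langle z,w\rangle}$. The $H^2_d$-energy of a Borel probability measure $\mu$ on $\partial\mathbb{B}_d$ is $$\mathcal{E}(\mu) = \sup_{0 \le r < 1} \int_{\partial\mathbb{B}_d}\int_{\partial\mathbb{B}_d} \operatorname{Re} K(rz,rw)\, d\mu(w)\, d\mu(z) \in [0,\infty].$$ For compact $E \subset \partial\mathbb{B}_d$, $\operatorname{cap}_{H^2_d}(E) = \sup\{1/\mathcal{E}(\mu) : \mu$ a Borel probability measure supported on $E\}$ (with $1/\infty = 0$ and $\operatorname{cap}(\emptyset)=0$). *)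

theory Defs
  imports "HOL-Probability.Probability"
begin

text \<open>
  \<open>complex ^ 'n\<close> carries the Euclidean norm, so \<open>ball 0 1\<close> and \<open>sphere 0 1\<close> are the open unit
  ball and the unit sphere of \<open>\<complex>\<^sup>d\<close> with \<open>d = CARD('n)\<close>.
  The Hermitian inner product below is linear in its first argument; the library's \<open>\<bullet>\<close> on
  this type is only its real part.
\<close>

definition cinner_vec :: "complex ^ 'n \<Rightarrow> complex ^ 'n \<Rightarrow> complex"
  where "cinner_vec z w = (\<Sum>i\<in>UNIV. z $ i * cnj (w $ i))"

definition holomorphic_vec_on :: "(complex ^ 'n \<Rightarrow> complex) \<Rightarrow> (complex ^ 'n) set \<Rightarrow> bool"
  where "holomorphic_vec_on f S \<longleftrightarrow>
    (\<forall>z\<in>S. \<exists>f'. (f has_derivative f') (at z) \<and> (\<forall>c v. f' (c *s v) = c * f' v))"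

text \<open>
  A complex Hilbert space \<open>H\<close>, with inner product \<open>ip\<close> (linear in the first argument), of
  functions on the set \<open>X\<close>. A function on \<open>X\<close> is represented by its extension by zero, so that
  equality of elements of \<open>H\<close> is equality on \<open>X\<close>. Nothing is assumed about \<open>ip\<close> outside \<open>H\<close>.
\<close>

locale function_hilbert_space =
  fixes X :: "'a set"
    and H :: "('a \<Rightarrow> complex) set"
    and ip :: "('a \<Rightarrow> complex) \<Rightarrow> ('a \<Rightarrow> complex) \<Rightarrow> complex"
  assumes zero_outside: "\<lbrakk>f \<in> H; x \<notin> X\<rbrakk> \<Longrightarrow> f x = 0"
    and zero_mem: "(\<lambda>x. 0) \<in> H"
    and add_mem: "\<lbrakk>f \<in> H; g \<in> H\<rbrakk> \<Longrightarrow> (\<lambda>x. f x + g x) \<in> H"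
    and scale_mem: "f \<in> H \<Longrightarrow> (\<lambda>x. c * f x) \<in> H"
    and ip_add: "\<lbrakk>f \<in> H; g \<in> H; h \<in> H\<rbrakk> \<Longrightarrow> ip (\<lambda>x. f x + g x) h = ip f h + ip g h"
    and ip_scale: "\<lbrakk>f \<in> H; g \<in> H\<rbrakk> \<Longrightarrow> ip (\<lambda>x. c * f x) g = c * ip f g"
    and ip_cnj: "\<lbrakk>f \<in> H; g \<in> H\<rbrakk> \<Longrightarrow> ip g f = cnj (ip f g)"
    and ip_nonneg: "f \<in> H \<Longrightarrow> Re (ip f f) \<ge> 0"
    and ip_definite: "\<lbrakk>f \<in> H; ip f f = 0\<rbrakk> \<Longrightarrow> f = (\<lambda>x. 0)"
    and complete:
      "\<lbrakk>\<And>n. F n \<in> H;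
        \<And>e. e > 0 \<Longrightarrow> \<exists>N. \<forall>m\<ge>N. \<forall>n\<ge>N.
          sqrt (Re (ip (\<lambda>x. F m x - F n x) (\<lambda>x. F m x - F n x))) < e\<rbrakk>
        \<Longrightarrow> \<exists>f\<in>H. (\<lambda>n::nat. sqrt (Re (ip (\<lambda>x. F n x - f x) (\<lambda>x. F n x - f x)))) \<longlonglongrightarrow> 0"

locale rkhs = function_hilbert_space X H ip
  for X :: "'a set"
    and K :: "'a \<Rightarrow> 'a \<Rightarrow> complex"
    and H :: "('a \<Rightarrow> complex) set"
    and ip :: "('a \<Rightarrow> complex) \<Rightarrow> ('a \<Rightarrow> complex) \<Rightarrow> complex" +
  assumes kernel_mem: "w \<in> X \<Longrightarrow> (\<lambda>z. if z \<in> X then K z w else 0) \<in> H"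
    and reproducing:
      "\<lbrakk>f \<in> H; w \<in> X\<rbrakk> \<Longrightarrow> f w = ip f (\<lambda>z. if z \<in> X then K z w else 0)"

definition da_kernel :: "complex ^ 'n \<Rightarrow> complex ^ 'n \<Rightarrow> complex"
  where "da_kernel z w = 1 / (1 - cinner_vec z w)"

text \<open>
  By the Moore--Aronszajn theorem there is exactly one pair \<open>(H, ip)\<close> as below, so this set is
  the Drury--Arveson space \<open>H\<^sup>2\<^sub>d\<close>.
\<close>

definition drury_arveson :: "(complex ^ 'n \<Rightarrow> complex) set"
  where "drury_arveson =
    {f. \<exists>H ip. rkhs (ball 0 1) da_kernel H ip \<and>
          (\<forall>h\<in>H. holomorphic_vec_on h (ball 0 1)) \<and> f \<in> H}"

definition sphere_prob_measures :: "(complex ^ 'n) measure set"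
  where "sphere_prob_measures =
    {\<mu>. sets \<mu> = sets (restrict_space borel (sphere 0 1)) \<and> prob_space \<mu>}"

text \<open>
  The real part of the kernel is positive on the ball and \<open>\<mu>\<close> is finite, so the real double
  integral is of a bounded continuous function and \<open>ennreal\<close> truncates nothing.
\<close>

definition da_energy :: "(complex ^ 'n) measure \<Rightarrow> ennreal"
  where "da_energy \<mu> =
    (SUP r\<in>{0..<1}. ennreal
      (\<integral>z. (\<integral>w. Re (da_kernel (r *\<^sub>R z) (r *\<^sub>R w)) \<partial>\<mu>) \<partial>\<mu>))"

text \<open>
  In \<open>ennreal\<close>, \<open>1 / \<infinity> = 0\<close> and the supremum of the empty set is \<open>0\<close>; the latter gives
  capacity \<open>0\<close> to the empty set. For compact \<open>E\<close>, a measure is supported on \<open>E\<close> iff the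
  complement of \<open>E\<close> is a null set.
\<close>

definition da_cap :: "(complex ^ 'n) set \<Rightarrow> ennreal"
  where "da_cap E =
    (SUP \<mu>\<in>{\<mu> \<in> sphere_prob_measures. AE x in \<mu>. x \<in> E}. 1 / da_energy \<mu>)"

end

theory Submission
  imports Defs
begin

text \<open>
  For \<open>r < 1\<close> consider the convex hull of the kernel functions \<open>K(\<cdot>, r w)\<close> with \<open>w \<in> E\<close>. If the squared
  norms of suitable elements \<open>g\<^sub>r\<close> of these hulls stayed bounded as \<open>r \<longlongrightarrow> 1\<close>, a weak limit of the
  corresponding discrete measures would be a probability measure on \<open>E\<close> of finite energy; so
  capacity zero forces the minimal norm to infinity. If \<open>g = \<Sum> u\<^sub>i K(\<cdot>, r w\<^sub>i)\<close> nearly minimises the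
  norm, convexity gives \<open>Re g(r w) > \<parallel>g\<parallel>\<^sup>2 / 2\<close> on \<open>E\<close>. Then \<open>h = \<Sum> u\<^sub>i K(\<cdot>, r\<^sup>2 w\<^sub>i)\<close> has norm at most \<open>\<parallel>g\<parallel>\<close>,
  positive real part, and radial boundary values \<open>g(r w)\<close> on \<open>E\<close>. Hence \<open>2 h / \<parallel>g\<parallel>\<^sup>2\<close> is small in norm
  while its real part is positive on the ball and exceeds \<open>1\<close> near \<open>E\<close> radially; summing such
  functions with norms \<open>2\<^sup>-\<^sup>n\<close> gives the desired function.
\<close>

subsection \<open>Square-summable families\<close>

text \<open>The space is complex, but the type class instance below records it as a real inner
  product space through the real part of \<open>cip\<close>. Norms, limits and convexity then come
  from the class, while \<open>smul\<close> and \<open>cip\<close> keep the complex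
  structure.\<close>

typedef 'i l2 = "{a :: 'i \<Rightarrow> complex. (\<lambda>i. (norm (a i))\<^sup>2) summable_on UNIV}"
  morphisms coord Abs_l2
  by (rule exI[of _ "\<lambda>_. 0"]) simp

lemma summable_coord: "(\<lambda>i. (norm (coord a i))\<^sup>2) summable_on UNIV"
  using coord[of a] by simp

lemma coord_Abs:
  assumes "(\<lambda>i. (norm (a i))\<^sup>2) summable_on UNIV"
  shows "coord (Abs_l2 a) = a"
  using assms by (simp add: Abs_l2_inverse)

lemma l2_eqI: "(\<And>i. coord a i = coord b i) \<Longrightarrow> a = b"
  by (metis coord_inject ext)

lemma summable_square_add:
  fixes a b :: "'i \<Rightarrow> complex"
  assumes "(\<lambda>i. (norm (a i))\<^sup>2) summable_on UNIV" "(\<lambda>i. (norm (b i))\<^sup>2) summable_on UNIV"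
  shows "(\<lambda>i. (norm (a i + b i))\<^sup>2) summable_on UNIV"
proof (rule summable_on_comparison_test)
  show "(\<lambda>i. 2 * (norm (a i))\<^sup>2 + 2 * (norm (b i))\<^sup>2) summable_on UNIV"
    using assms by (intro summable_on_add summable_on_cmult_right)
  fix i
  have "(norm (a i + b i))\<^sup>2 \<le> (norm (a i) + norm (b i))\<^sup>2"
    by (intro power_mono norm_triangle_ineq) auto
  also have "\<dots> \<le> 2 * (norm (a i))\<^sup>2 + 2 * (norm (b i))\<^sup>2"
    using sum_squares_bound[of "norm (a i)" "norm (b i)"] by (simp add: power2_sum)
  finally show "(norm (a i + b i))\<^sup>2 \<le> 2 * (norm (a i))\<^sup>2 + 2 * (norm (b i))\<^sup>2" .
qed auto

lemma summable_square_cmult: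
  fixes a :: "'i \<Rightarrow> complex"
  assumes "(\<lambda>i. (norm (a i))\<^sup>2) summable_on UNIV"
  shows "(\<lambda>i. (norm (c * a i))\<^sup>2) summable_on UNIV"
  unfolding norm_mult power_mult_distrib using assms by (rule summable_on_cmult_right)

lemma summable_cnj_mult:
  fixes a b :: "'i \<Rightarrow> complex"
  assumes "(\<lambda>i. (norm (a i))\<^sup>2) summable_on UNIV" "(\<lambda>i. (norm (b i))\<^sup>2) summable_on UNIV"
  shows "(\<lambda>i. a i * cnj (b i)) summable_on UNIV"
proof (rule abs_summable_summable, rule summable_on_comparison_test)
  show "(\<lambda>i. (norm (a i))\<^sup>2 + (norm (b i))\<^sup>2) summable_on UNIV"
    using assms by (intro summable_on_add)
  fix i
  have "2 * norm (a i) * norm (b i) \<le> (norm (a i))\<^sup>2 + (norm (b i))\<^sup>2"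
    by (rule sum_squares_bound)
  then show "norm (a i * cnj (b i)) \<le> (norm (a i))\<^sup>2 + (norm (b i))\<^sup>2"
    using mult_nonneg_nonneg[OF norm_ge_zero[of "a i"] norm_ge_zero[of "b i"]]
    unfolding norm_mult complex_mod_cnj by linarith
qed auto

section \<open>Complex scalars and the complex inner product\<close>

definition smul :: "complex \<Rightarrow> 'i l2 \<Rightarrow> 'i l2"
  where "smul c a = Abs_l2 (\<lambda>i. c * coord a i)"

definition cip :: "'i l2 \<Rightarrow> 'i l2 \<Rightarrow> complex"
  where "cip a b = (\<Sum>\<^sub>\<infinity>i. coord a i * cnj (coord b i))"

lemma coord_smul [simp]: "coord (smul c a) i = c * coord a i"
  unfolding smul_def by (subst coord_Abs) (auto intro!: summable_square_cmult summable_coord)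

lemma has_sum_cip: "((\<lambda>i. coord a i * cnj (coord b i)) has_sum cip a b) UNIV"
  unfolding cip_def by (intro has_sum_infsum summable_cnj_mult summable_coord)

lemma cip_cnj: "cip b a = cnj (cip a b)"
  unfolding cip_def by (subst infsum_cnj[symmetric]) (simp add: mult.commute)

lemma cip_smul_left: "cip (smul c a) b = c * cip a b"
  using has_sum_cmult_right[OF has_sum_cip[of a b], of c] has_sum_cip[of "smul c a" b]
  by (simp add: mult.assoc has_sum_unique)

instantiation l2 :: (type) real_inner
begin

definition "0 = Abs_l2 (\<lambda>_. 0)"
definition "a + b = Abs_l2 (\<lambda>i. coord a i + coord b i)"
definition "- a = smul (-1) a" for a :: "'a l2"
definition "a - b = a + - b" for a b :: "'a l2"
definition "r *\<^sub>R a = smul (complex_of_real r) a" for a :: "'a l2"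
definition "inner a b = Re (cip a b)"
definition "norm a = sqrt (inner a a)" for a :: "'a l2"
definition "sgn a = inverse (norm a) *\<^sub>R a" for a :: "'a l2"
definition "dist a b = norm (a - b)" for a b :: "'a l2"
definition [code del]: "(uniformity :: ('a l2 \<times> 'a l2) filter) =
  (INF e\<in>{0<..}. principal {(a, b). dist a b < e})"
definition [code del]: "open (S :: 'a l2 set) \<longleftrightarrow>
  (\<forall>a\<in>S. eventually (\<lambda>(a', b). a' = a \<longrightarrow> b \<in> S) (uniformity :: ('a l2 \<times> 'a l2) filter))"

lemma coord_zero: "coord 0 i = 0"
  by (simp add: zero_l2_def coord_Abs)

lemma coord_add: "coord (a + b) i = coord a i + coord b i"
  unfolding plus_l2_def by (subst coord_Abs) (auto intro!: summable_square_add summable_coord)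

lemma coord_uminus: "coord (- a) i = - coord a i"
  by (simp add: uminus_l2_def)

lemma coord_diff: "coord (a - b) i = coord a i - coord b i"
  by (simp add: minus_l2_def coord_add coord_uminus)

lemma coord_scaleR: "coord (r *\<^sub>R a) i = r *\<^sub>R coord a i"
  by (simp add: scaleR_l2_def scaleR_conv_of_real)

lemma cip_add_left: "cip (a + b) c = cip a c + cip b c"
  using has_sum_add[OF has_sum_cip[of a c] has_sum_cip[of b c]] has_sum_cip[of "a + b" c]
  by (simp add: coord_add distrib_right has_sum_unique)

lemma has_sum_inner_self: "((\<lambda>i. (norm (coord a i))\<^sup>2) has_sum inner a a) UNIV"
  using has_sum_Re[OF has_sum_cip[of a a]] by (simp add: inner_l2_def complex_mult_cnj cmod_power2)

instance
proof
  fix a b c :: "'a l2" and r s :: real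
  show "a + b + c = a + (b + c)" "a + b = b + a" "0 + a = a" "- a + a = 0" "a - b = a + - b"
    "r *\<^sub>R (a + b) = r *\<^sub>R a + r *\<^sub>R b" "(r + s) *\<^sub>R a = r *\<^sub>R a + s *\<^sub>R a"
    "r *\<^sub>R s *\<^sub>R a = (r * s) *\<^sub>R a" "1 *\<^sub>R a = a"
    by (rule l2_eqI, simp add: coord_zero coord_add coord_uminus coord_diff coord_scaleR algebra_simps)+
  show "sgn a = inverse (norm a) *\<^sub>R a" "norm a = sqrt (inner a a)" "dist a b = norm (a - b)"
    by (simp_all only: sgn_l2_def norm_l2_def dist_l2_def)
  show "uniformity = (INF e\<in>{0<..}. principal {(a :: 'a l2, b). dist a b < e})"
    by (rule uniformity_l2_def)
  show "open S = (\<forall>a\<in>S. \<forall>\<^sub>F (a', b) in uniformity. a' = a \<longrightarrow> b \<in> S)" for S :: "'a l2 set"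
    by (rule open_l2_def)
  show "inner a b = inner b a"
    by (simp add: inner_l2_def cip_cnj[of a b])
  show "inner (a + b) c = inner a c + inner b c"
    by (simp add: inner_l2_def cip_add_left)
  show "inner (r *\<^sub>R a) b = r * inner a b"
    by (simp add: inner_l2_def scaleR_l2_def cip_smul_left)
  show "inner a a \<ge> 0"
    by (rule has_sum_nonneg[OF has_sum_inner_self]) simp
  show "inner a a = 0 \<longleftrightarrow> a = 0"
  proof
    assume "inner a a = 0"
    then have "(norm (coord a i))\<^sup>2 = 0" for i
      by (intro nonneg_has_sum_le_0D[OF has_sum_inner_self[of a]]) auto
    then show "a = 0"
      by (intro l2_eqI) (simp add: coord_zero)
  next
    assume "a = 0"
    then show "inner a a = 0"
      using has_sum_inner_self[of a] by (simp add: coord_zero has_sum_0_simp has_sum_unique)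
  qed
qed

end

lemmas coord_simps [simp] = coord_zero coord_add coord_uminus coord_diff coord_scaleR

lemma coord_sum [simp]: "coord (sum f A) i = (\<Sum>x\<in>A. coord (f x) i)"
  by (induction A rule: infinite_finite_induct) auto

section \<open>Complex inner product and norm in terms of coordinates\<close>

lemma Re_cip: "Re (cip a b) = inner a b"
  by (simp add: inner_l2_def)

lemma scaleR_eq_smul: "r *\<^sub>R a = smul (of_real r) a" for a :: "'i l2"
  by (rule scaleR_l2_def)

lemma cip_scaleR_left: "cip (r *\<^sub>R a) b = of_real r * cip a b"
  by (simp add: scaleR_eq_smul cip_smul_left)

lemma cip_diff_left: "cip (a - b) c = cip a c - cip b c"
  using cip_add_left[of "a - b" b c] by simp

lemma cip_zero_left [simp]: "cip 0 b = 0"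
  by (simp add: cip_def)

lemma cip_sum_left: "cip (sum f A) b = (\<Sum>x\<in>A. cip (f x) b)"
  by (induction A rule: infinite_finite_induct) (auto simp: cip_add_left)

lemma cip_self: "cip a a = of_real ((norm a)\<^sup>2)"
proof -
  have "((\<lambda>i. of_real ((norm (coord a i))\<^sup>2)) has_sum (of_real (inner a a) :: complex)) UNIV"
    by (intro has_sum_of_real has_sum_inner_self)
  moreover have "of_real ((norm (coord a i))\<^sup>2) = coord a i * cnj (coord a i)" for i
    by (rule complex_norm_square)
  ultimately have "cip a a = of_real (inner a a)"
    using has_sum_cip[of a a] by (metis (no_types, lifting) has_sum_cong has_sum_unique)
  then show ?thesis
    by (simp add: power2_norm_eq_inner)
qed

lemma has_sum_norm_l2: "((\<lambda>i. (norm (coord a i))\<^sup>2) has_sum (norm a)\<^sup>2) UNIV"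
  using has_sum_inner_self[of a] by (simp add: power2_norm_eq_inner)

text \<open>Rotating the second argument by \<open>\<i>\<close> moves the imaginary part into the
  real one. Thus both parts of \<open>cip\<close> are real inner products, from which its continuity
  follows.\<close>

lemma Im_cip: "Im (cip a b) = inner a (smul \<i> b)"
proof -
  have "cip a (smul \<i> b) = - \<i> * cip a b"
    unfolding cip_cnj[of a "smul \<i> b"] cip_smul_left by (simp add: cip_cnj[of a b])
  then show ?thesis
    by (simp add: inner_l2_def)
qed

lemma bounded_linear_cip_left: "bounded_linear (\<lambda>a. cip a b)"
proof -
  have "cip a b = of_real (inner a b) + \<i> * of_real (inner a (smul \<i> b))" for a
    by (simp add: complex_eq_iff Re_cip Im_cip)
  then have "(\<lambda>a. cip a b) = (\<lambda>a. of_real (inner a b) + \<i> * of_real (inner a (smul \<i> b)))"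
    by auto
  moreover have "bounded_linear (\<lambda>a. of_real (inner a b) + \<i> * of_real (inner a (smul \<i> b)) :: complex)"
    by (intro bounded_linear_add bounded_linear_compose[OF bounded_linear_mult_right]
        bounded_linear_compose[OF bounded_linear_of_real] bounded_linear_inner_left)
  ultimately show ?thesis
    by simp
qed

lemma sum_coord_le_norm: "finite F \<Longrightarrow> (\<Sum>i\<in>F. (norm (coord a i))\<^sup>2) \<le> (norm a)\<^sup>2"
  by (rule finite_sum_le_has_sum[OF has_sum_norm_l2]) auto

lemma norm_coord_le: "norm (coord a i) \<le> norm a"
  using sum_coord_le_norm[of "{i}" a] by (simp add: power2_le_iff_abs_le)

lemma norm_l2_mono:
  assumes "\<And>i. norm (coord a i) \<le> norm (coord b i)"
  shows "norm a \<le> norm b"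
proof -
  have "(norm a)\<^sup>2 \<le> (norm b)\<^sup>2"
    by (rule has_sum_mono[OF has_sum_norm_l2 has_sum_norm_l2]) (auto intro: power_mono assms)
  then show ?thesis
    by (simp add: power2_le_iff_abs_le)
qed

lemma square_sum_bounded_l2:
  fixes a :: "'i \<Rightarrow> complex"
  assumes "\<And>F. finite F \<Longrightarrow> (\<Sum>i\<in>F. (norm (a i))\<^sup>2) \<le> B"
  shows "(\<lambda>i. (norm (a i))\<^sup>2) summable_on UNIV"
  by (rule nonneg_bdd_above_summable_on) (auto intro!: bdd_aboveI[of _ B] assms)

lemma norm_l2_le:
  assumes "\<And>F. finite F \<Longrightarrow> (\<Sum>i\<in>F. (norm (coord a i))\<^sup>2) \<le> B\<^sup>2" "B \<ge> 0"
  shows "norm a \<le> B"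
proof -
  have "(norm a)\<^sup>2 \<le> B\<^sup>2"
    by (rule has_sum_le_finite_sums[OF has_sum_norm_l2]) (use assms in auto)
  then show ?thesis
    using assms(2) by (simp add: power2_le_iff_abs_le)
qed

text \<open>The candidate limit is taken coordinatewise. The Cauchy bound on a finite partial sum
  survives the limit in one of the two indices, uniformly in the finite set; this gives both
  square-summability of the limit and convergence in norm.\<close>

instance l2 :: (type) complete_space
proof
  fix X :: "nat \<Rightarrow> 'a l2"
  assume X: "Cauchy X"
  have "Cauchy (\<lambda>n. coord (X n) i)" for i
  proof (rule CauchyI)
    fix e :: real assume "e > 0"
    then obtain N where N: "\<forall>m\<ge>N. \<forall>n\<ge>N. norm (X m - X n) < e"
      using X unfolding Cauchy_iff by blast
    have "norm (coord (X m) i - coord (X n) i) < e" if "m \<ge> N" "n \<ge> N" for m n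
      using norm_coord_le[of "X m - X n" i] N that by (force simp del: coord_diff simp: coord_diff[symmetric])
    then show "\<exists>N. \<forall>m\<ge>N. \<forall>n\<ge>N. norm (coord (X m) i - coord (X n) i) < e"
      by blast
  qed
  then have "\<forall>i. \<exists>l. (\<lambda>n. coord (X n) i) \<longlonglongrightarrow> l"
    by (simp add: Cauchy_convergent convergent_def[symmetric])
  then obtain a where a: "\<And>i. (\<lambda>n. coord (X n) i) \<longlonglongrightarrow> a i"
    by metis
  have bound: "(\<Sum>i\<in>F. (norm (coord (X m) i - a i))\<^sup>2) \<le> e\<^sup>2"
    if "finite F" "m \<ge> N" and N: "\<forall>m\<ge>N. \<forall>n\<ge>N. norm (X m - X n) < e" for e N F m
  proof (rule tendsto_upperbound)
    show "(\<lambda>n. \<Sum>i\<in>F. (norm (coord (X m) i - coord (X n) i))\<^sup>2) \<longlonglongrightarrow> (\<Sum>i\<in>F. (norm (coord (X m) i - a i))\<^sup>2)"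
      by (intro tendsto_intros a)
    have "(\<Sum>i\<in>F. (norm (coord (X m) i - coord (X n) i))\<^sup>2) \<le> e\<^sup>2" if "n \<ge> N" for n
    proof -
      have "(\<Sum>i\<in>F. (norm (coord (X m - X n) i))\<^sup>2) \<le> (norm (X m - X n))\<^sup>2"
        by (rule sum_coord_le_norm) fact
      also have "\<dots> \<le> e\<^sup>2"
        using N \<open>m \<ge> N\<close> that by (intro power_mono) (auto intro: less_imp_le)
      finally show ?thesis by simp
    qed
    then show "\<forall>\<^sub>F n in sequentially. (\<Sum>i\<in>F. (norm (coord (X m) i - coord (X n) i))\<^sup>2) \<le> e\<^sup>2"
      by (auto simp: eventually_sequentially)
  qed simp
  obtain N1 where N1: "\<forall>m\<ge>N1. \<forall>n\<ge>N1. norm (X m - X n) < 1"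
    using X unfolding Cauchy_iff by (meson zero_less_one)
  \<comment> \<open>The limit is recovered as \<open>coord (X N1)\<close> minus this difference,
    both of which are square-summable.\<close>
  have "(\<lambda>i. (norm (coord (X N1) i - a i))\<^sup>2) summable_on UNIV"
    by (rule square_sum_bounded_l2[where B = "1\<^sup>2"]) (rule bound[OF _ order_refl N1])
  then have "(\<lambda>i. (norm (coord (X N1) i + (-1) * (coord (X N1) i - a i)))\<^sup>2) summable_on UNIV"
    by (intro summable_square_add summable_square_cmult summable_coord)
  then have summ: "(\<lambda>i. (norm (a i))\<^sup>2) summable_on UNIV"
    by simp
  have "X \<longlonglongrightarrow> Abs_l2 a"
    unfolding LIMSEQ_iff
  proof (intro allI impI)
    fix r :: real assume "r > 0"
    then obtain N where N: "\<forall>m\<ge>N. \<forall>n\<ge>N. norm (X m - X n) < r / 2"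
      using X unfolding Cauchy_iff by (meson half_gt_zero)
    have "norm (X n - Abs_l2 a) \<le> r / 2" if "n \<ge> N" for n
      by (rule norm_l2_le) (use bound[OF _ that N] \<open>r > 0\<close> in \<open>auto simp: coord_Abs[OF summ]\<close>)
    then show "\<exists>no. \<forall>n\<ge>no. norm (X n - Abs_l2 a) < r"
      using \<open>r > 0\<close> by (intro exI[of _ N]) force
  qed
  then show "convergent X"
    by (rule convergentI)
qed

subsection \<open>The reproducing kernel Hilbert space of a feature map\<close>

text \<open>
  The double orthogonal complement of the feature vectors, that is, their closed span. Distinct
  elements induce distinct functions, so the inner product transfers without a projection.
\<close>

definition feature_span :: "('a \<Rightarrow> 'i l2) \<Rightarrow> 'a set \<Rightarrow> 'i l2 set"
  where "feature_span \<phi> X = {a. \<forall>b. (\<forall>x\<in>X. cip b (\<phi> x) = 0) \<longrightarrow> cip a b = 0}"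

definition feature_fun :: "('a \<Rightarrow> 'i l2) \<Rightarrow> 'a set \<Rightarrow> 'i l2 \<Rightarrow> 'a \<Rightarrow> complex"
  where "feature_fun \<phi> X a = (\<lambda>x. if x \<in> X then cip a (\<phi> x) else 0)"

lemma feature_spanD: "a \<in> feature_span \<phi> X \<Longrightarrow> (\<And>x. x \<in> X \<Longrightarrow> cip b (\<phi> x) = 0) \<Longrightarrow> cip a b = 0"
  by (auto simp: feature_span_def)

lemma feature_span_mem: "x \<in> X \<Longrightarrow> \<phi> x \<in> feature_span \<phi> X"
  by (auto simp: feature_span_def) (metis cip_cnj complex_cnj_zero)

lemma feature_span_zero: "0 \<in> feature_span \<phi> X"
  by (auto simp: feature_span_def)

lemma feature_span_add:
  "a \<in> feature_span \<phi> X \<Longrightarrow> b \<in> feature_span \<phi> X \<Longrightarrow> a + b \<in> feature_span \<phi> X"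
  by (auto simp: feature_span_def cip_add_left)

lemma feature_span_smul: "a \<in> feature_span \<phi> X \<Longrightarrow> smul c a \<in> feature_span \<phi> X"
  by (auto simp: feature_span_def cip_smul_left)

lemma feature_span_scaleR: "a \<in> feature_span \<phi> X \<Longrightarrow> r *\<^sub>R a \<in> feature_span \<phi> X"
  by (simp add: scaleR_eq_smul feature_span_smul)

lemma feature_span_diff:
  "a \<in> feature_span \<phi> X \<Longrightarrow> b \<in> feature_span \<phi> X \<Longrightarrow> a - b \<in> feature_span \<phi> X"
  by (auto simp: feature_span_def cip_diff_left)

lemma feature_span_sum:
  "(\<And>x. x \<in> A \<Longrightarrow> f x \<in> feature_span \<phi> X) \<Longrightarrow> sum f A \<in> feature_span \<phi> X"
  by (induction A rule: infinite_finite_induct) (auto intro: feature_span_zero feature_span_add)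

lemma feature_span_limit:
  assumes "\<And>n. f n \<in> feature_span \<phi> X" "f \<longlonglongrightarrow> a"
  shows "a \<in> feature_span \<phi> X"
  unfolding feature_span_def
proof (intro CollectI allI impI)
  fix b assume "\<forall>x\<in>X. cip b (\<phi> x) = 0"
  then have "cip (f n) b = 0" for n
    using feature_spanD[OF assms(1)] by blast
  moreover have "(\<lambda>n. cip (f n) b) \<longlonglongrightarrow> cip a b"
    by (rule bounded_linear.tendsto[OF bounded_linear_cip_left assms(2)])
  ultimately show "cip a b = 0"
    by (simp add: LIMSEQ_const_iff)
qed

lemma feature_fun_add: "feature_fun \<phi> X (a + b) = (\<lambda>x. feature_fun \<phi> X a x + feature_fun \<phi> X b x)"
  by (auto simp: feature_fun_def cip_add_left)

lemma feature_fun_diff: "feature_fun \<phi> X (a - b) = (\<lambda>x. feature_fun \<phi> X a x - feature_fun \<phi> X b x)"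
  by (auto simp: feature_fun_def cip_diff_left)

lemma feature_fun_smul: "feature_fun \<phi> X (smul c a) = (\<lambda>x. c * feature_fun \<phi> X a x)"
  by (auto simp: feature_fun_def cip_smul_left)

text \<open>A vector of the double complement that is orthogonal to all feature vectors is
  orthogonal to itself.\<close>

lemma feature_fun_eq_0:
  assumes "a \<in> feature_span \<phi> X" "feature_fun \<phi> X a = (\<lambda>x. 0)"
  shows "a = 0"
proof -
  have "cip a (\<phi> x) = 0" if "x \<in> X" for x
    using fun_cong[OF assms(2), of x] that by (simp add: feature_fun_def)
  then have "cip a a = 0"
    by (rule feature_spanD[OF assms(1)])
  then show ?thesis
    by (simp add: cip_self)
qed

lemma inj_on_feature_fun: "inj_on (feature_fun \<phi> X) (feature_span \<phi> X)"
proof (rule inj_onI)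
  fix a b assume *: "a \<in> feature_span \<phi> X" "b \<in> feature_span \<phi> X" "feature_fun \<phi> X a = feature_fun \<phi> X b"
  then have "a - b = 0"
    by (intro feature_fun_eq_0[of _ \<phi> X] feature_span_diff) (auto simp: feature_fun_diff)
  then show "a = b" by simp
qed

text \<open>Evaluation at \<open>w\<close> is by construction the inner product with
  \<open>\<phi> w\<close>, whose function is the kernel at \<open>w\<close>; this is the reproducing
  property. Completeness holds because the span is closed in a complete space.\<close>

proposition rkhs_feature:
  fixes \<phi> :: "'a \<Rightarrow> 'i l2"
  assumes K: "\<And>z w. z \<in> X \<Longrightarrow> w \<in> X \<Longrightarrow> K z w = cip (\<phi> w) (\<phi> z)"
  defines "M \<equiv> feature_span \<phi> X" and "F \<equiv> feature_fun \<phi> X"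
  shows "rkhs X K (F ` M) (\<lambda>f g. cip (inv_into M F f) (inv_into M F g))"
proof -
  define ip where "ip = (\<lambda>f g. cip (inv_into M F f) (inv_into M F g))"
  have inv: "inv_into M F (F a) = a" if "a \<in> M" for a
    using that inv_into_f_f[OF inj_on_feature_fun] by (simp add: M_def F_def)
  have ip: "ip (F a) (F b) = cip a b" if "a \<in> M" "b \<in> M" for a b
    using that by (simp add: ip_def inv)
  note cl = feature_span_add[of _ \<phi> X, folded M_def] feature_span_smul[of _ \<phi> X, folded M_def]
    feature_span_diff[of _ \<phi> X, folded M_def]
  note F = feature_fun_add[of \<phi> X, folded F_def, symmetric] feature_fun_smul[of \<phi> X, folded F_def, symmetric]
    feature_fun_diff[of \<phi> X, folded F_def, symmetric]
  have kernel: "(\<lambda>z. if z \<in> X then K z w else 0) = F (\<phi> w)" if "w \<in> X" for w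
    using that by (auto simp: F_def feature_fun_def K)
  have \<phi>: "\<phi> w \<in> M" if "w \<in> X" for w
    using that by (simp add: M_def feature_span_mem)
  have "rkhs X K (F ` M) ip"
  proof
    fix f x assume "f \<in> F ` M" "x \<notin> X"
    then show "f x = 0"
      by (auto simp: F_def feature_fun_def)
  next
    show "(\<lambda>x. 0) \<in> F ` M"
      by (rule image_eqI[of _ _ 0]) (auto simp: F_def M_def feature_fun_def feature_span_zero)
  next
    fix f g assume "f \<in> F ` M" "g \<in> F ` M"
    then show "(\<lambda>x. f x + g x) \<in> F ` M"
      by (auto simp: F intro!: imageI cl)
  next
    fix f and c :: complex assume "f \<in> F ` M"
    then show "(\<lambda>x. c * f x) \<in> F ` M"
      by (auto simp: F intro!: imageI cl)
  next
    fix f g h assume "f \<in> F ` M" "g \<in> F ` M" "h \<in> F ` M"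
    then show "ip (\<lambda>x. f x + g x) h = ip f h + ip g h"
      by (auto simp: F ip cl cip_add_left)
  next
    fix f g and c :: complex assume "f \<in> F ` M" "g \<in> F ` M"
    then show "ip (\<lambda>x. c * f x) g = c * ip f g"
      by (auto simp: F ip cl cip_smul_left)
  next
    fix f g assume "f \<in> F ` M" "g \<in> F ` M"
    then show "ip g f = cnj (ip f g)"
      by (auto simp: ip intro: cip_cnj)
  next
    fix f assume "f \<in> F ` M"
    then show "Re (ip f f) \<ge> 0"
      by (auto simp: ip Re_cip)
  next
    fix f assume "f \<in> F ` M" "ip f f = 0"
    then obtain a where "f = F a" "cip a a = 0"
      by (auto simp: ip)
    then show "f = (\<lambda>x. 0)"
      by (auto simp: cip_self F_def feature_fun_def)
  next
    fix G :: "nat \<Rightarrow> 'a \<Rightarrow> complex"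
    assume G: "\<And>n. G n \<in> F ` M"
      and Cauchy: "\<And>e. e > 0 \<Longrightarrow> \<exists>N. \<forall>m\<ge>N. \<forall>n\<ge>N.
          sqrt (Re (ip (\<lambda>x. G m x - G n x) (\<lambda>x. G m x - G n x))) < e"
    obtain a where a: "\<And>n. a n \<in> M" "\<And>n. G n = F (a n)"
    proof -
      have "\<forall>n. \<exists>a. a \<in> M \<and> G n = F a"
        using G by blast
      then show thesis
        using that by metis
    qed
    \<comment> \<open>Stated for every \<open>b\<close> in \<open>M\<close>, so that it serves both
      the Cauchy condition and the convergence to the limit.\<close>
    have norm: "sqrt (Re (ip (\<lambda>x. G m x - F b x) (\<lambda>x. G m x - F b x))) = norm (a m - b)" if "b \<in> M" for m b
      using that a by (simp add: F ip cl Re_cip norm_eq_sqrt_inner)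
    have "sqrt (Re (ip (\<lambda>x. G m x - G n x) (\<lambda>x. G m x - G n x))) = norm (a m - a n)" for m n
      using norm[OF a(1)[of n], of m] unfolding a(2)[of n] .
    then have "Cauchy a"
      unfolding Cauchy_iff using Cauchy by simp
    then obtain b where b: "a \<longlonglongrightarrow> b"
      using Cauchy_convergent convergent_def by blast
    then have "b \<in> M"
      using a(1) unfolding M_def by (rule feature_span_limit[rotated])
    moreover have "(\<lambda>n. norm (a n - b)) \<longlonglongrightarrow> 0"
      using b by (simp add: LIM_zero tendsto_norm_zero)
    ultimately show "\<exists>f\<in>F ` M. (\<lambda>n. sqrt (Re (ip (\<lambda>x. G n x - f x) (\<lambda>x. G n x - f x)))) \<longlonglongrightarrow> 0"
      by (auto simp: norm)
  next
    fix w assume "w \<in> X"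
    then show "(\<lambda>z. if z \<in> X then K z w else 0) \<in> F ` M"
      by (simp add: kernel \<phi>)
  next
    fix f w assume "f \<in> F ` M" "w \<in> X"
    then show "f w = ip f (\<lambda>z. if z \<in> X then K z w else 0)"
      by (auto simp: kernel ip \<phi>) (simp add: F_def feature_fun_def)
  qed
  then show ?thesis
    unfolding ip_def .
qed

subsection \<open>The Drury--Arveson space\<close>

definition word_monom :: "complex ^ 'n \<Rightarrow> 'n list \<Rightarrow> complex"
  where "word_monom z xs = prod_list (map (\<lambda>i. z $ i) xs)"

lemma word_monom_simps [simp]:
  "word_monom z [] = 1"
  "word_monom z (i # xs) = z $ i * word_monom z xs"
  by (simp_all add: word_monom_def)

section \<open>Sums over words grouped by length\<close>

lemma finite_words [simp]: "finite {xs :: 'n::finite list. length xs = N}"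
  using finite_lists_length_eq[of "UNIV :: 'n set" N] by simp

lemma finite_words_less [simp]: "finite {xs :: 'n::finite list. length xs < N}"
proof -
  have "{xs :: 'n list. length xs < N} = (\<Union>k<N. {xs. length xs = k})" by auto
  then show ?thesis by simp
qed

lemma sum_words_Suc:
  fixes f :: "'n::finite list \<Rightarrow> 'b::comm_monoid_add"
  shows "(\<Sum>xs | length xs = Suc N. f xs) = (\<Sum>i\<in>UNIV. \<Sum>xs | length xs = N. f (i # xs))"
proof -
  have "(\<Sum>i\<in>UNIV. \<Sum>xs | length xs = N. f (i # xs)) = (\<Sum>(i, xs)\<in>UNIV \<times> {xs. length xs = N}. f (i # xs))"
    by (simp add: sum.cartesian_product)
  also have "\<dots> = (\<Sum>xs | length xs = Suc N. f xs)"
    by (rule sum.reindex_bij_witness[of _ "\<lambda>xs. (hd xs, tl xs)" "\<lambda>(i, xs). i # xs"])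
       (auto simp: length_Suc_conv)
  finally show ?thesis ..
qed

lemma sum_words_less:
  fixes f :: "'n::finite list \<Rightarrow> 'b::comm_monoid_add"
  shows "(\<Sum>xs | length xs < N. f xs) = (\<Sum>k<N. \<Sum>xs | length xs = k. f xs)"
proof -
  have "{xs :: 'n list. length xs < N} = (\<Union>k<N. {xs. length xs = k})" by auto
  then show ?thesis
    by (simp add: sum.UNION_disjoint disjoint_iff)
qed

text \<open>The sets of words of length below \<open>N\<close> are finite and eventually contain
  every finite set of words, so the unordered sum is also the limit along them.\<close>

lemma has_sum_words_sums:
  fixes f :: "'n::finite list \<Rightarrow> 'b::{comm_monoid_add, topological_space}"
  assumes "(f has_sum s) UNIV"
  shows "(\<lambda>N. \<Sum>xs | length xs = N. f xs) sums s"
proof -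
  have "filterlim (\<lambda>N. {xs :: 'n list. length xs < N}) (finite_subsets_at_top UNIV) sequentially"
    unfolding filterlim_finite_subsets_at_top
  proof (intro allI impI)
    fix X :: "'n list set" assume X: "finite X \<and> X \<subseteq> UNIV"
    define m where "m = Max (length ` X)"
    have "length xs < N" if "xs \<in> X" "Suc m \<le> N" for xs N
    proof -
      have "length xs \<le> m"
        using that X by (auto simp: m_def)
      then show ?thesis
        using that by simp
    qed
    then show "\<forall>\<^sub>F N in sequentially. finite {xs :: 'n list. length xs < N}
        \<and> X \<subseteq> {xs. length xs < N} \<and> {xs. length xs < N} \<subseteq> UNIV"
      unfolding eventually_sequentially by (intro exI[of _ "Suc m"]) auto
  qed
  from filterlim_compose[OF assms[unfolded has_sum_def] this] show ?thesis
    by (simp add: sums_def sum_words_less)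
qed

text \<open>Multiplying out the \<open>N\<close>-th power of a sum over coordinates produces exactly
  one term for each word of length \<open>N\<close>.\<close>

lemma sum_word_monom:
  "(\<Sum>xs | length xs = N. word_monom z xs * cnj (word_monom w xs)) = cinner_vec z w ^ N"
proof (induction N)
  case (Suc N)
  have "(\<Sum>xs | length xs = Suc N. word_monom z xs * cnj (word_monom w xs)) =
    (\<Sum>i\<in>UNIV. \<Sum>xs | length xs = N. (z $ i * cnj (w $ i)) * (word_monom z xs * cnj (word_monom w xs)))"
    unfolding sum_words_Suc by (simp add: mult_ac)
  also have "\<dots> = cinner_vec z w * cinner_vec z w ^ N"
    by (simp add: sum_distrib_left[symmetric] Suc cinner_vec_def sum_distrib_right)
  finally show ?case by simp
qed simp

section \<open>The Hermitian inner product and the feature vectors of the kernel\<close>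

lemma cinner_vec_self: "cinner_vec z z = of_real ((norm z)\<^sup>2)"
proof -
  have "(norm z)\<^sup>2 = (\<Sum>i\<in>UNIV. (norm (z $ i))\<^sup>2)"
    by (simp add: norm_vec_def L2_set_def sum_nonneg)
  then show ?thesis
    by (simp only: cinner_vec_def of_real_sum complex_norm_square)
qed

lemma cinner_vec_scaleR: "cinner_vec (r *\<^sub>R z) (s *\<^sub>R w) = of_real (r * s) * cinner_vec z w"
  by (simp add: cinner_vec_def sum_distrib_left scaleR_conv_of_real[where 'a = complex] mult_ac)

lemma norm_cinner_vec_le: "norm (cinner_vec z w) \<le> norm z * norm w"
proof -
  have "norm (cinner_vec z w) \<le> (\<Sum>i\<in>UNIV. \<bar>norm (z $ i)\<bar> * \<bar>norm (w $ i)\<bar>)"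
    unfolding cinner_vec_def by (rule order_trans[OF norm_sum]) (simp add: norm_mult)
  also have "\<dots> \<le> norm z * norm w"
    unfolding norm_vec_def by (rule L2_set_mult_ineq)
  finally show ?thesis .
qed

lemma sum_norm_word_monom: "(\<Sum>xs | length xs = N. (norm (word_monom z xs))\<^sup>2) = ((norm z)\<^sup>2) ^ N"
proof -
  have "complex_of_real (\<Sum>xs | length xs = N. (norm (word_monom z xs))\<^sup>2) = of_real (((norm z)\<^sup>2) ^ N)"
    by (simp only: of_real_sum of_real_power[of _ N] cinner_vec_self[symmetric] sum_word_monom[symmetric]
        complex_norm_square)
  then show ?thesis
    by (simp only: of_real_eq_iff)
qed

lemma word_monom_scaleR: "word_monom (r *\<^sub>R z) xs = of_real r ^ length xs * word_monom z xs"
  by (induction xs) (simp_all add: scaleR_conv_of_real[where 'a = complex] mult_ac)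

text \<open>
  Words are used instead of multi-indices: they turn the powers of the kernel into sums without
  multinomial coefficients, at the price of repeating every monomial.
\<close>

definition da_vec :: "complex ^ 'n \<Rightarrow> 'n list l2"
  where "da_vec w = Abs_l2 (\<lambda>xs. cnj (word_monom w xs))"

text \<open>The words of length \<open>k\<close> contribute \<open>((norm w)\<^sup>2) ^ k\<close>,
  so square-summability is convergence of a geometric series. On and outside the unit sphere the
  family is not square-summable and \<open>da_vec w\<close> is unspecified.\<close>

lemma coord_da_vec [simp]:
  fixes w :: "complex ^ 'n"
  assumes "norm w < 1"
  shows "coord (da_vec w) xs = cnj (word_monom w xs)"
proof -
  have *: "(norm w)\<^sup>2 < 1"
    using assms by (simp add: power_less_one_iff)
  have "(\<lambda>xs. (norm (cnj (word_monom w xs)))\<^sup>2) summable_on UNIV"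
  proof (rule square_sum_bounded_l2)
    fix F :: "'n list set" assume F: "finite F"
    define m where "m = Suc (Max (length ` F))"
    have "F \<subseteq> {xs. length xs < m}"
      using F Max_ge[of "length ` F"] by (auto simp: m_def less_Suc_eq_le)
    then have "(\<Sum>xs\<in>F. (norm (cnj (word_monom w xs)))\<^sup>2) \<le> (\<Sum>xs | length xs < m. (norm (word_monom w xs))\<^sup>2)"
      unfolding complex_mod_cnj by (intro sum_mono2) auto
    also have "\<dots> = (\<Sum>k<m. ((norm w)\<^sup>2) ^ k)"
      by (simp add: sum_words_less sum_norm_word_monom)
    also have "\<dots> \<le> (\<Sum>k. ((norm w)\<^sup>2) ^ k)"
      using * by (intro sum_le_suminf summable_geometric) auto
    finally show "(\<Sum>xs\<in>F. (norm (cnj (word_monom w xs)))\<^sup>2) \<le> (\<Sum>k. ((norm w)\<^sup>2) ^ k)" .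
  qed
  then show ?thesis
    by (simp add: da_vec_def coord_Abs)
qed

lemma cip_da_vec_sums:
  assumes "norm z < 1"
  shows "(\<lambda>N. \<Sum>xs | length xs = N. coord a xs * word_monom z xs) sums cip a (da_vec z)"
  using has_sum_words_sums[OF has_sum_cip[of a "da_vec z"]] assms by simp

lemma norm_cinner_vec_less_1:
  assumes "norm z < 1" "norm w \<le> 1"
  shows "norm (cinner_vec z w) < 1"
proof -
  have "norm (cinner_vec z w) \<le> norm z * norm w"
    by (rule norm_cinner_vec_le)
  also have "\<dots> \<le> norm z * 1"
    using assms by (intro mult_left_mono) auto
  finally show ?thesis using assms by simp
qed

text \<open>Grouped by word length, the inner product is the geometric series of
  \<open>cinner_vec z w\<close>. Hence \<open>da_vec\<close> is a feature map for the kernel, with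
  the arguments in the order that \<open>rkhs_feature\<close> expects.\<close>

lemma cip_da_vec_da_vec:
  assumes "norm z < 1" "norm w < 1"
  shows "cip (da_vec w) (da_vec z) = da_kernel z w"
proof -
  have "(\<lambda>N. cinner_vec z w ^ N) sums cip (da_vec w) (da_vec z)"
    using cip_da_vec_sums[OF assms(1), of "da_vec w"] assms
    by (simp add: sum_word_monom[symmetric] mult.commute)
  moreover have "(\<lambda>N. cinner_vec z w ^ N) sums (1 / (1 - cinner_vec z w))"
    using norm_cinner_vec_less_1[of z w] assms by (intro geometric_sums) auto
  ultimately show ?thesis
    unfolding da_kernel_def by (rule sums_unique2)
qed

section \<open>Termwise differentiation and holomorphy\<close>

primrec word_deriv :: "complex ^ 'n \<Rightarrow> complex ^ 'n \<Rightarrow> 'n list \<Rightarrow> complex" where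
  "word_deriv z h [] = 0"
| "word_deriv z h (i # xs) = h $ i * word_monom z xs + z $ i * word_deriv z h xs"

lemma has_derivative_word_monom:
  "((\<lambda>z. word_monom z xs) has_derivative (\<lambda>h. word_deriv z h xs)) (at z within S)"
proof (induction xs)
  case (Cons i xs)
  have "((\<lambda>z. z $ i) has_derivative (\<lambda>h. h $ i)) (at z within S)"
    by (rule bounded_linear_imp_has_derivative) (rule bounded_linear_vec_nth)
  from has_derivative_mult[OF this Cons] show ?case
    by (simp add: add.commute)
qed simp

lemma word_deriv_smult: "word_deriv z (c *s h) xs = c * word_deriv z h xs"
  by (induction xs) (simp_all add: algebra_simps)

text \<open>Splitting off the first letter factors such an L2 norm into a vector norm and an L2 norm
  over shorter words. The product rule then yields the recursion of
  \<open>N * norm z ^ (N - 1) * norm h\<close>.\<close>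

lemma L2_set_word_deriv_le:
  "L2_set (\<lambda>xs. norm (word_deriv z h xs)) {xs. length xs = N} \<le> real N * norm z ^ (N - 1) * norm h"
proof (induction N)
  case (Suc N)
  have L2: "L2_set (\<lambda>xs. norm (u $ hd xs * f (tl xs))) {xs. length xs = Suc N} =
      norm u * L2_set (\<lambda>xs. norm (f xs)) {xs. length xs = N}"
    for u :: "complex ^ 'n" and f :: "'n list \<Rightarrow> complex"
    unfolding L2_set_def sum_words_Suc norm_vec_def
    by (simp add: norm_mult power_mult_distrib sum_distrib_left[symmetric] sum_distrib_right[symmetric] real_sqrt_mult)
  have "L2_set (\<lambda>xs. norm (word_deriv z h xs)) {xs. length xs = Suc N} \<le>
    L2_set (\<lambda>xs. norm (h $ hd xs * word_monom z (tl xs)) + norm (z $ hd xs * word_deriv z h (tl xs))) {xs. length xs = Suc N}"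
    by (rule L2_set_mono) (auto simp: length_Suc_conv intro: norm_triangle_ineq)
  also have "\<dots> \<le> L2_set (\<lambda>xs. norm (h $ hd xs * word_monom z (tl xs))) {xs. length xs = Suc N} +
      L2_set (\<lambda>xs. norm (z $ hd xs * word_deriv z h (tl xs))) {xs. length xs = Suc N}"
    by (rule L2_set_triangle_ineq)
  also have "\<dots> = norm h * norm z ^ N + norm z * L2_set (\<lambda>xs. norm (word_deriv z h xs)) {xs. length xs = N}"
  proof -
    have "L2_set (\<lambda>xs. norm (word_monom z xs)) {xs. length xs = N} = norm z ^ N"
      unfolding L2_set_def sum_norm_word_monom by (simp add: real_sqrt_power)
    then show ?thesis
      by (simp only: L2)
  qed
  also have "\<dots> \<le> norm h * norm z ^ N + norm z * (real N * norm z ^ (N - 1) * norm h)"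
    by (intro add_left_mono mult_left_mono Suc) auto
  also have "\<dots> = real (Suc N) * norm z ^ (Suc N - 1) * norm h"
    by (cases N) (simp_all add: algebra_simps)
  finally show ?case .
qed simp

text \<open>The homogeneous expansion is differentiated termwise on a smaller ball of radius
  \<open>\<rho>\<close>. By Cauchy-Schwarz the derivative of the part of degree \<open>N\<close> is
  at most \<open>N * \<rho> ^ (N - 1) * norm a * norm h\<close>, a summable bound uniform on that
  ball; complex homogeneity passes from the terms to the sum.\<close>

lemma holomorphic_cip_da_vec:
  fixes a :: "'n::finite list l2"
  shows "holomorphic_vec_on (feature_fun da_vec (ball 0 1) a) (ball 0 1)"
  unfolding holomorphic_vec_on_def
proof
  fix z0 :: "complex ^ 'n" assume "z0 \<in> ball 0 1"
  then obtain \<rho> where \<rho>: "norm z0 < \<rho>" "\<rho> < 1"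
    using dense[of "norm z0" 1] by auto
  then have "0 < \<rho>"
    using norm_ge_zero[of z0] by linarith
  define S :: "(complex ^ 'n) set" where "S = ball 0 \<rho>"
  define f where "f = (\<lambda>N z. \<Sum>xs | length xs = N. coord a xs * word_monom z xs)"
  define f' where "f' = (\<lambda>N z h. \<Sum>xs | length xs = N. coord a xs * word_deriv z h xs)"
  define g' where "g' = (\<lambda>z h. \<Sum>N. f' N z h)"
  define b where "b = (\<lambda>N. real N * \<rho> ^ (N - 1))"
  have "summable (\<lambda>N. b (Suc N))"
    using geometric_deriv_sums[of \<rho>] \<rho> \<open>0 < \<rho>\<close> by (auto simp: b_def sums_iff)
  then have b: "summable b"
    by (subst (asm) summable_Suc_iff)
  have f'_le: "norm (f' N z h) \<le> b N * (norm a * norm h)" if "z \<in> S" for N z h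
  proof -
    have "norm (f' N z h) \<le> (\<Sum>xs | length xs = N. \<bar>norm (coord a xs)\<bar> * \<bar>norm (word_deriv z h xs)\<bar>)"
      unfolding f'_def by (rule order_trans[OF norm_sum]) (simp add: norm_mult)
    also have "\<dots> \<le> L2_set (\<lambda>xs. norm (coord a xs)) {xs. length xs = N} *
        L2_set (\<lambda>xs. norm (word_deriv z h xs)) {xs. length xs = N}"
      by (rule L2_set_mult_ineq)
    also have "\<dots> \<le> norm a * (real N * norm z ^ (N - 1) * norm h)"
    proof (intro mult_mono L2_set_word_deriv_le L2_set_nonneg norm_ge_zero)
      show "L2_set (\<lambda>xs. norm (coord a xs)) {xs. length xs = N} \<le> norm a"
        unfolding L2_set_def by (rule real_le_lsqrt) (auto intro!: sum_coord_le_norm sum_nonneg)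
    qed
    also have "\<dots> \<le> norm a * (real N * \<rho> ^ (N - 1) * norm h)"
      using that \<open>0 < \<rho>\<close> by (intro mult_mono mult_nonneg_nonneg power_mono) (auto simp: S_def)
    finally show ?thesis
      by (simp add: b_def mult_ac)
  qed
  have summ: "summable (\<lambda>N. f' N z h)" if "z \<in> S" for z h
    by (rule summable_comparison_test'[where N = 0, OF summable_mult2[OF b]]) (rule f'_le[OF that])
  have "\<exists>g. \<forall>x\<in>S. (\<lambda>n. f n x) sums (g x) \<and> (g has_derivative g' x) (at x within S)"
  proof (rule has_derivative_series)
    show "convex S" by (simp add: S_def)
    show "(f n has_derivative f' n x) (at x within S)" for n x
      unfolding f_def f'_def
      by (intro has_derivative_sum has_derivative_mult_right has_derivative_word_monom)
    show "z0 \<in> S" using \<rho> by (simp add: S_def)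
    show "(\<lambda>n. f n z0) sums cip a (da_vec z0)"
      unfolding f_def using \<rho> by (intro cip_da_vec_sums) auto
    fix e :: real assume "e > 0"
    \<comment> \<open>The summand 1 keeps the denominator positive when
      \<open>a = 0\<close>.\<close>
    then have "e / (norm a + 1) > 0"
      by (intro divide_pos_pos) (auto intro: add_nonneg_pos)
    then obtain N where N: "\<forall>n\<ge>N. norm (\<Sum>i. b (i + n)) < e / (norm a + 1)"
      using suminf_exist_split[OF _ b] by blast
    have "norm ((\<Sum>i<n. f' i x h) - g' x h) \<le> e * norm h" if "n \<ge> N" "x \<in> S" for n x h
    proof -
      have eq: "(\<Sum>i<n. f' i x h) - g' x h = - (\<Sum>i. f' (i + n) x h)"
        using suminf_split_initial_segment[OF summ[OF that(2)], of h n] by (simp add: g'_def)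
      have sb: "summable (\<lambda>i. b (i + n))"
        using b by (rule summable_ignore_initial_segment)
      have "norm ((\<Sum>i<n. f' i x h) - g' x h) \<le> (\<Sum>i. b (i + n) * (norm a * norm h))"
        unfolding eq norm_minus_cancel
        by (rule norm_suminf_le[OF f'_le[OF that(2)] summable_mult2[OF sb]])
      also have "\<dots> = (\<Sum>i. b (i + n)) * (norm a * norm h)"
        by (rule suminf_mult2[OF sb, symmetric])
      also have "\<dots> \<le> e / (norm a + 1) * ((norm a + 1) * norm h)"
        using N[rule_format, OF that(1)] \<open>e > 0\<close>
        by (intro mult_mono mult_nonneg_nonneg) auto
      also have "\<dots> = e * norm h"
        using add_nonneg_pos[OF norm_ge_zero[of a] zero_less_one] by simp
      finally show ?thesis .
    qed
    then show "\<forall>\<^sub>F n in sequentially. \<forall>x\<in>S. \<forall>h. norm ((\<Sum>i<n. f' i x h) - g' x h) \<le> e * norm h"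
      unfolding eventually_sequentially by blast
  qed
  then obtain g where g: "\<And>x. x \<in> S \<Longrightarrow> (\<lambda>n. f n x) sums (g x)"
      "\<And>x. x \<in> S \<Longrightarrow> (g has_derivative g' x) (at x within S)"
    by blast
  have eq: "g x = feature_fun da_vec (ball 0 1) a x" if "x \<in> S" for x
    using sums_unique2[OF g(1)[OF that]] cip_da_vec_sums[of x a] that \<rho>
    by (auto simp: f_def S_def feature_fun_def)
  have S: "open S" "z0 \<in> S"
    using \<rho> by (auto simp: S_def)
  have "(g has_derivative g' z0) (at z0)"
    using g(2)[OF S(2)] at_within_open[OF S(2,1)] by simp
  then have "(feature_fun da_vec (ball 0 1) a has_derivative g' z0) (at z0)"
    by (rule has_derivative_transform_within_open[OF _ S]) (rule eq)
  moreover have "g' z0 (c *s v) = c * g' z0 v" for c v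
  proof -
    have "f' N z0 (c *s v) = c * f' N z0 v" for N
      by (simp add: f'_def word_deriv_smult sum_distrib_left mult_ac)
    then show ?thesis
      using summ[of z0] \<rho> by (simp add: g'_def S_def suminf_mult)
  qed
  ultimately show "\<exists>f'. (feature_fun da_vec (ball 0 1) a has_derivative f') (at z0) \<and>
      (\<forall>c v. f' (c *s v) = c * f' v)"
    by blast
qed

text \<open>Membership asks for some reproducing kernel Hilbert space with holomorphic elements that
  contains the function; the feature space of \<open>da_vec\<close> is the witness.\<close>

proposition feature_fun_in_drury_arveson:
  fixes a :: "'n::finite list l2"
  assumes "a \<in> feature_span da_vec (ball 0 1)"
  shows "feature_fun da_vec (ball 0 1) a \<in> drury_arveson"
proof -
  define M where "M = feature_span da_vec (ball 0 1 :: (complex ^ 'n) set)"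
  define F where "F = feature_fun da_vec (ball 0 1 :: (complex ^ 'n) set)"
  have "rkhs (ball 0 1) da_kernel (F ` M) (\<lambda>f g. cip (inv_into M F f) (inv_into M F g))"
    unfolding M_def F_def by (rule rkhs_feature) (simp add: cip_da_vec_da_vec)
  moreover have "\<forall>h\<in>F ` M. holomorphic_vec_on h (ball 0 1)"
    by (auto simp: F_def intro: holomorphic_cip_da_vec)
  ultimately show ?thesis
    using assms unfolding drury_arveson_def M_def F_def by blast
qed

subsection \<open>A continuous curve through the unit ball\<close>

text \<open>
  Schoenberg's space-filling curve: this function reads off the first ternary digit of points of
  the Cantor set, modulo even integers, and is continuous on the whole line.
\<close>

definition cantor_digit :: "real \<Rightarrow> real"
  where "cantor_digit t = max 0 (min 1 (1 / 2 - cos (pi * t)))"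

lemma cantor_digit_bounds: "0 \<le> cantor_digit t" "cantor_digit t \<le> 1"
  by (auto simp: cantor_digit_def)

lemma continuous_on_cantor_digit: "continuous_on S (\<lambda>t. cantor_digit (c * t))"
  unfolding cantor_digit_def by (intro continuous_intros)

text \<open>Modulo 2, the cosine of \<open>pi * s\<close> is at least 1/2 on the first third of the
  unit interval and, by reflection, at most -1/2 on the last third. The truncation to the unit
  interval turns these bounds into the exact values 0 and 1.\<close>

lemma cantor_digit_eq:
  assumes "0 \<le> u" "u \<le> 1 / 3"
  shows "cantor_digit (2 * of_int k + (2 * of_bool b / 3 + u)) = of_bool b"
proof -
  have periodic: "cos (pi * (2 * of_int k + s)) = cos (pi * s)" for s
    using sin_int_2pin[of k] cos_int_2pin[of k] by (simp add: distrib_left cos_add mult_ac)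
  have half: "cos (pi * s) \<ge> 1 / 2" if "0 \<le> s" "s \<le> 1 / 3" for s
  proof -
    have "pi * s \<le> pi * (1 / 3)"
      using that by (intro mult_left_mono) auto
    then have "cos (pi / 3) \<le> cos (pi * s)"
      using that by (intro cos_monotone_0_pi_le) auto
    then show ?thesis by (simp add: cos_60)
  qed
  show ?thesis
  proof (cases b)
    case True
    have "cos (pi * (2 / 3 + u)) = - cos (pi * (1 / 3 - u))"
    proof -
      have "pi * (2 / 3 + u) = pi - pi * (1 / 3 - u)"
        by (simp add: algebra_simps)
      then show ?thesis
        by (simp only: cos_pi_minus)
    qed
    then show ?thesis
      using half[of "1 / 3 - u"] assms True by (simp add: cantor_digit_def periodic)
  next
    case False
    then show ?thesis
      using half[of u] assms by (simp add: cantor_digit_def periodic)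
  qed
qed

text \<open>The point of the Cantor set whose ternary digits are 0 and 2 according to
  \<open>b\<close>.\<close>

definition cantor_point :: "(nat \<Rightarrow> bool) \<Rightarrow> real"
  where "cantor_point b = (\<Sum>i. 2 / 3 * of_bool (b i) * (1 / 3) ^ i)"

lemma summable_cantor_point: "summable (\<lambda>i. 2 / 3 * of_bool (b i) * (1 / 3) ^ i :: real)"
  by (rule summable_comparison_test'[where N = 0, OF summable_mult[where c = "2 / 3", OF summable_geometric[of "1 / 3 :: real"]]]) auto

lemma cantor_point_bounds: "0 \<le> cantor_point b" "cantor_point b \<le> 1"
proof -
  show "0 \<le> cantor_point b"
    unfolding cantor_point_def by (rule suminf_nonneg[OF summable_cantor_point]) auto
  have "cantor_point b \<le> (\<Sum>i. 2 / 3 * (1 / 3) ^ i)"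
    unfolding cantor_point_def
    by (rule suminf_le[OF _ summable_cantor_point summable_mult[OF summable_geometric]]) auto
  also have "\<dots> = 1"
    by (subst suminf_mult) (auto simp: suminf_geometric summable_geometric)
  finally show "cantor_point b \<le> 1" .
qed

lemma cantor_point_split: "3 * cantor_point b = 2 * of_bool (b 0) + cantor_point (\<lambda>i. b (Suc i))"
proof -
  have "cantor_point b = 2 / 3 * of_bool (b 0) + (\<Sum>i. 2 / 3 * of_bool (b (Suc i)) * (1 / 3) ^ Suc i)"
    unfolding cantor_point_def using suminf_split_head[OF summable_cantor_point[of b]] by simp
  also have "(\<Sum>i. 2 / 3 * of_bool (b (Suc i)) * (1 / 3) ^ Suc i) = 1 / 3 * cantor_point (\<lambda>i. b (Suc i))"
    unfolding cantor_point_def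
    by (subst suminf_mult[OF summable_cantor_point, symmetric]) (simp add: mult_ac)
  finally show ?thesis by simp
qed

text \<open>Multiplication by \<open>3 ^ i\<close> shifts the ternary expansion by \<open>i\<close>
  places. The integer split off is even, since all digits are 0 or 2, so the period 2 of
  \<open>cantor_digit\<close> removes it.\<close>

lemma cantor_digit_cantor_point: "cantor_digit (3 ^ i * cantor_point b) = of_bool (b i)"
proof -
  have "\<exists>k :: int. 3 ^ i * cantor_point b = 2 * of_int k + cantor_point (\<lambda>j. b (i + j))"
  proof (induction i)
    case 0
    then show ?case by (intro exI[of _ 0]) simp
  next
    case (Suc i)
    then obtain k :: int where "3 ^ i * cantor_point b = 2 * of_int k + cantor_point (\<lambda>j. b (i + j))"
      by blast
    then have "3 ^ Suc i * cantor_point b = 2 * of_int (3 * k + of_bool (b i)) + cantor_point (\<lambda>j. b (Suc i + j))"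
      using cantor_point_split[of "\<lambda>j. b (i + j)"] by simp
    then show ?case by blast
  qed
  then obtain k :: int where "3 ^ i * cantor_point b = 2 * of_int k + cantor_point (\<lambda>j. b (i + j))" ..
  moreover have "cantor_point (\<lambda>j. b (i + j)) = 2 * of_bool (b i) / 3 + cantor_point (\<lambda>j. b (Suc (i + j))) / 3"
    using cantor_point_split[of "\<lambda>j. b (i + j)"] by simp
  ultimately show ?thesis
    using cantor_digit_eq[of "cantor_point (\<lambda>j. b (Suc (i + j))) / 3" k "b i"]
      cantor_point_bounds[of "\<lambda>j. b (Suc (i + j))"] by simp
qed

text \<open>The digits are the parities of the floors of \<open>2 ^ Suc k * x\<close>; with them the
  partial sums are the dyadic roundings of \<open>x\<close> from below.\<close>

lemma binary_expansion:
  fixes x :: real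
  assumes "0 \<le> x" "x < 1"
  shows "\<exists>b. (\<lambda>k. of_bool (b k) * (1 / 2) ^ Suc k) sums x"
proof -
  define b where "b = (\<lambda>k. odd \<lfloor>2 ^ Suc k * x\<rfloor>)"
  have sum: "(\<Sum>k<n. of_bool (b k) * (1 / 2 :: real) ^ Suc k) = of_int \<lfloor>2 ^ n * x\<rfloor> * (1 / 2) ^ n" for n
  proof (induction n)
    case 0
    have "\<lfloor>x\<rfloor> = 0" using assms by linarith
    then show ?case by simp
  next
    case (Suc n)
    define y where "y = 2 ^ n * x"
    have "\<lfloor>2 * y\<rfloor> = 2 * \<lfloor>y\<rfloor> \<or> \<lfloor>2 * y\<rfloor> = 2 * \<lfloor>y\<rfloor> + 1"
      by linarith
    then have "\<lfloor>2 * y\<rfloor> = 2 * \<lfloor>y\<rfloor> + of_bool (odd \<lfloor>2 * y\<rfloor>)"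
      by auto
    then have floor: "\<lfloor>2 * y\<rfloor> = 2 * \<lfloor>y\<rfloor> + of_bool (b n)"
      by (simp add: b_def y_def mult.assoc)
    have y: "2 ^ Suc n * x = 2 * y"
      by (simp add: y_def)
    show ?case
      unfolding sum.lessThan_Suc Suc y floor y_def[symmetric] by (simp add: distrib_right)
  qed
  have "(\<lambda>n. of_int \<lfloor>2 ^ n * x\<rfloor> * (1 / 2) ^ n) \<longlonglongrightarrow> x"
  proof (rule tendsto_sandwich)
    have *: "x = 2 ^ n * x * (1 / 2) ^ n" for n
      by (simp add: power_one_over)
    have "(2 ^ n * x - 1) * (1 / 2) ^ n \<le> of_int \<lfloor>2 ^ n * x\<rfloor> * (1 / 2) ^ n" for n
      by (intro mult_right_mono) (linarith, simp)
    then show "\<forall>\<^sub>F n in sequentially. x - (1 / 2) ^ n \<le> of_int \<lfloor>2 ^ n * x\<rfloor> * (1 / 2) ^ n"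
      by (simp add: left_diff_distrib *[symmetric])
    have "of_int \<lfloor>2 ^ n * x\<rfloor> * (1 / 2) ^ n \<le> 2 ^ n * x * (1 / 2) ^ n" for n
      by (intro mult_right_mono) auto
    then show "\<forall>\<^sub>F n in sequentially. of_int \<lfloor>2 ^ n * x\<rfloor> * (1 / 2) ^ n \<le> x"
      by (simp add: *[symmetric])
    show "(\<lambda>n. x - (1 / 2) ^ n) \<longlonglongrightarrow> x"
      by (rule tendsto_eq_intros LIMSEQ_power_zero | simp)+
  qed simp
  then show ?thesis
    unfolding sums_def by (intro exI[of _ b]) (simp only: sum)
qed

text \<open>The digits read off the parameter are distributed by \<open>prod_encode\<close> into one
  binary expansion per coordinate. Each coordinate is a uniformly convergent series of continuous
  functions, and a suitable Cantor point realises any prescribed digits.\<close>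

proposition continuous_curve_covering_cball:
  "\<exists>\<Phi> :: real \<Rightarrow> 'a::euclidean_space.
    continuous_on UNIV \<Phi> \<and> bounded (range \<Phi>) \<and> cball 0 1 \<subseteq> \<Phi> ` {0..1}"
proof -
  define idx where "idx = to_nat_on (Basis :: 'a set)"
  define X where "X = (\<lambda>j t. \<Sum>k. cantor_digit (3 ^ prod_encode (j, k) * t) * (1 / 2) ^ Suc k)"
  \<comment> \<open>The affine rescaling places the coordinates of the unit ball at values between
    1/4 and 3/4, inside the half-open range of \<open>binary_expansion\<close>.\<close>
  define \<Phi> :: "real \<Rightarrow> 'a" where "\<Phi> = (\<lambda>t. \<Sum>u\<in>Basis. (4 * X (idx u) t - 2) *\<^sub>R u)"
  have half: "(\<lambda>k. (1 / 2 :: real) ^ Suc k) sums 1"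
    by (rule power_half_series)
  have term_le: "norm (cantor_digit s * (1 / 2) ^ Suc k) \<le> (1 / 2) ^ Suc k" for s k
    using cantor_digit_bounds[of s] by (simp add: abs_mult mult_left_le_one_le)
  have cont: "continuous_on UNIV (X j)" for j
    unfolding X_def
  proof (rule uniform_limit_theorem)
    show "uniform_limit UNIV (\<lambda>n t. \<Sum>k<n. cantor_digit (3 ^ prod_encode (j, k) * t) * (1 / 2) ^ Suc k)
        (\<lambda>t. \<Sum>k. cantor_digit (3 ^ prod_encode (j, k) * t) * (1 / 2) ^ Suc k) sequentially"
      by (rule Weierstrass_m_test[OF term_le sums_summable[OF half]])
  qed (auto intro!: always_eventually continuous_intros continuous_on_cantor_digit)
  have X_bounds: "\<bar>X j t\<bar> \<le> 1" for j t
  proof -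
    have "norm (X j t) \<le> (\<Sum>k. (1 / 2) ^ Suc k)"
      unfolding X_def by (rule norm_suminf_le[OF term_le sums_summable[OF half]])
    then show ?thesis
      using sums_unique[OF half] by simp
  qed
  have "norm (\<Phi> t) \<le> (\<Sum>u\<in>(Basis::'a set). 6)" for t
    unfolding \<Phi>_def
  proof (rule sum_norm_le)
    fix u :: 'a assume "u \<in> Basis"
    then show "norm ((4 * X (idx u) t - 2) *\<^sub>R u) \<le> 6"
      using X_bounds[of "idx u" t] by simp
  qed
  then have "bounded (range \<Phi>)"
    by (auto intro!: boundedI)
  moreover have "continuous_on UNIV \<Phi>"
    unfolding \<Phi>_def by (intro continuous_intros cont)
  moreover have "cball 0 1 \<subseteq> \<Phi> ` {0..1}"
  proof
    fix v :: 'a assume v: "v \<in> cball 0 1"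
    have "\<exists>b. (\<lambda>k. of_bool (b k) * (1 / 2) ^ Suc k) sums ((v \<bullet> u + 2) / 4)" if "u \<in> Basis" for u
    proof -
      have "\<bar>v \<bullet> u\<bar> \<le> 1"
        using Basis_le_norm[OF that, of v] v by simp
      then show ?thesis
        by (intro binary_expansion) auto
    qed
    then obtain \<beta> where \<beta>: "\<And>u. u \<in> Basis \<Longrightarrow> (\<lambda>k. of_bool (\<beta> u k) * (1 / 2) ^ Suc k) sums ((v \<bullet> u + 2) / 4)"
      by metis
    define b where "b = (\<lambda>i. case prod_decode i of (j, k) \<Rightarrow> \<beta> (from_nat_into Basis j) k)"
    have "X (idx u) (cantor_point b) = (v \<bullet> u + 2) / 4" if "u \<in> Basis" for u
    proof -
      have "b (prod_encode (idx u, k)) = \<beta> u k" for k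
        using that by (simp add: b_def idx_def countable_finite)
      then show ?thesis
        using sums_unique[OF \<beta>[OF that]] by (simp add: X_def cantor_digit_cantor_point)
    qed
    then have "\<Phi> (cantor_point b) = (\<Sum>u\<in>Basis. (v \<bullet> u) *\<^sub>R u)"
      unfolding \<Phi>_def by (intro sum.cong) (auto simp: field_simps)
    also have "\<dots> = v"
      by (rule euclidean_representation)
    finally show "v \<in> \<Phi> ` {0..1}"
      using cantor_point_bounds[of b] by (auto intro!: image_eqI[of _ _ "cantor_point b"])
  qed
  ultimately show ?thesis
    by blast
qed

subsection \<open>Weak limits of convex combinations of point masses\<close>

text \<open>
  Helly's selection theorem is applied on the line: the point masses are lifted along a continuous
  curve through the ball, and the limit measure is pushed forward along it.
\<close>

proposition convex_weights_weak_limit: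
  fixes E :: "'a::euclidean_space set"
  assumes "compact E" "E \<subseteq> cball 0 1"
    and fin: "\<And>n :: nat. finite (S n)"
    and w: "\<And>n x. x \<in> S n \<Longrightarrow> w n x \<in> E"
    and u: "\<And>n x. x \<in> S n \<Longrightarrow> 0 \<le> u n x" "\<And>n. sum (u n) (S n) = 1"
  obtains \<mu> :: "'a measure" and r :: "nat \<Rightarrow> nat"
  where "prob_space \<mu>" "sets \<mu> = sets borel" "AE x in \<mu>. x \<in> E" "strict_mono r"
    "\<And>f :: 'a \<Rightarrow> complex. continuous_on UNIV f \<Longrightarrow>
      (\<lambda>n. \<Sum>x\<in>S (r n). u (r n) x *\<^sub>R f (w (r n) x)) \<longlonglongrightarrow> (\<integral>x. f x \<partial>\<mu>)"
proof -
  obtain \<Phi> :: "real \<Rightarrow> 'a" where \<Phi>: "continuous_on UNIV \<Phi>" "bounded (range \<Phi>)" "cball 0 1 \<subseteq> \<Phi> ` {0..1}"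
    using continuous_curve_covering_cball by blast
  \<comment> \<open>The lifted masses all sit on this closed set of parameters, which will also
    carry the limit measure.\<close>
  define C where "C = {0..1} \<inter> \<Phi> -` E"
  have "closed C"
    unfolding C_def using \<Phi>(1) compact_imp_closed[OF \<open>compact E\<close>]
    by (intro closed_Int closed_atLeastAtMost) (simp add: continuous_on_closed_vimage)
  have "\<forall>x\<in>E. \<exists>t. t \<in> C \<and> \<Phi> t = x"
    using \<Phi>(3) \<open>E \<subseteq> cball 0 1\<close> by (force simp: C_def)
  then obtain \<tau> where \<tau>: "\<And>x. x \<in> E \<Longrightarrow> \<tau> x \<in> C" "\<And>x. x \<in> E \<Longrightarrow> \<Phi> (\<tau> x) = x"
    by metis
  define P where "P = (\<lambda>n. point_measure (S n) (u n))"
  define \<nu> where "\<nu> = (\<lambda>n. distr (P n) borel (\<lambda>x. \<tau> (w n x)))"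
  have P: "prob_space (P n)" for n
    unfolding P_def by (rule prob_space_point_measure) (use fin u in auto)
  \<comment> \<open>The sigma-algebra of \<open>point_measure\<close> is the full power set, so the
    arbitrary section \<open>\<tau>\<close> gives a measurable map.\<close>
  have meas: "(\<lambda>x. \<tau> (w n x)) \<in> borel_measurable (P n)" for n
    by (simp add: P_def)
  have \<nu>: "real_distribution (\<nu> n)" for n
    unfolding \<nu>_def by (rule prob_space.real_distribution_distr[OF P meas])
  have int: "(\<integral>t. f t \<partial>\<nu> n) = (\<Sum>x\<in>S n. u n x *\<^sub>R f (\<tau> (w n x)))"
    if "f \<in> borel_measurable borel" for f :: "real \<Rightarrow> 'c::{banach, second_countable_topology}" and n
  proof -
    have "(\<integral>t. f t \<partial>\<nu> n) = (\<integral>x. f (\<tau> (w n x)) \<partial>P n)"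
      unfolding \<nu>_def by (rule integral_distr[OF meas that])
    then show ?thesis
      unfolding P_def by (simp add: lebesgue_integral_point_measure_finite fin u)
  qed
  have "tight \<nu>"
    unfolding tight_def
  proof (intro conjI allI impI \<nu>)
    \<comment> \<open>The half-open interval starts at -1 in order to contain the parameter
      0.\<close>
    have "measure (\<nu> n) {-1<..1} = 1" for n
    proof -
      have "(\<lambda>x. \<tau> (w n x)) -` {-1<..1} \<inter> space (P n) = space (P n)"
        using \<tau>(1)[OF w] by (force simp: P_def space_point_measure C_def)
      then show ?thesis
        unfolding \<nu>_def by (subst measure_distr[OF meas]) (simp_all add: prob_space.prob_space[OF P])
    qed
    then show "\<exists>a b. a < b \<and> (\<forall>n. 1 - \<epsilon> < measure (\<nu> n) {a<..b})" if "\<epsilon> > 0" for \<epsilon> :: real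
      using that by (intro exI[of _ "-1"] exI[of _ 1]) auto
  qed
  from tight_imp_convergent_subsubsequence[OF this strict_mono_id]
  obtain r M where r: "strict_mono (r :: nat \<Rightarrow> nat)" and M: "real_distribution M"
    and conv: "weak_conv_m (\<lambda>n. \<nu> (r n)) M"
    by (auto simp: o_def)
  interpret M: real_distribution M by fact
  have lim: "(\<lambda>n. \<Sum>x\<in>S (r n). u (r n) x *\<^sub>R f (\<tau> (w (r n) x))) \<longlonglongrightarrow> (\<integral>t. f t \<partial>M)"
    if "continuous_on UNIV f" "\<And>t. norm (f t) \<le> B" for f :: "real \<Rightarrow> 'c::{banach, second_countable_topology}" and B
  proof -
    have "(\<lambda>n. \<integral>t. f t \<partial>\<nu> (r n)) \<longlonglongrightarrow> (\<integral>t. f t \<partial>M)"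
      using that by (intro weak_conv_imp_integral_bdd_continuous_conv[OF \<nu> M conv])
        (auto simp: continuous_on_eq_continuous_at)
    then show ?thesis
      using borel_measurable_continuous_onI[OF that(1)] by (simp add: int)
  qed
  have AE_C: "AE t in M. t \<in> C"
  proof -
    \<comment> \<open>The set \<open>C\<close> has to be nonempty because \<open>infdist\<close> to
      the empty set is 0 by convention.\<close>
    obtain x where "x \<in> S 0"
      using u(2)[of 0] by fastforce
    then have "C \<noteq> {}"
      using \<tau>(1) w by blast
    \<comment> \<open>A bounded continuous test function that vanishes exactly on \<open>C\<close>:
      its integrals along the sequence are 0, hence so is its integral in the limit.\<close>
    define g where "g = (\<lambda>t. min 1 (infdist t C))"
    have g: "continuous_on UNIV g" "\<And>t. norm (g t) \<le> 1" "\<And>t. 0 \<le> g t"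
      by (auto simp: g_def infdist_nonneg intro!: continuous_intros)
    have "g (\<tau> (w n x)) = 0" if "x \<in> S n" for n x
      using \<tau>(1)[OF w[OF that]] by (simp add: g_def)
    then have "(\<integral>t. g t \<partial>M) = 0"
      using lim[OF g(1,2)] by (simp add: LIMSEQ_const_iff)
    moreover have "integrable M g"
      using g(2) borel_measurable_continuous_onI[OF g(1)] by (intro M.integrable_const_bound[of _ 1]) auto
    ultimately have "AE t in M. g t = 0"
      using integral_nonneg_eq_0_iff_AE[of M g] g(3) by auto
    then show ?thesis
    proof eventually_elim
      case (elim t)
      then have "infdist t C = 0"
        by (simp add: g_def min_def split: if_splits)
      then show ?case
        using in_closed_iff_infdist_zero[OF \<open>closed C\<close> \<open>C \<noteq> {}\<close>] by simp
    qed
  qed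
  define \<mu> where "\<mu> = distr M borel \<Phi>"
  have \<Phi>_meas: "\<Phi> \<in> borel_measurable M"
    using borel_measurable_continuous_onI[OF \<Phi>(1)] by simp
  show thesis
  proof (rule that)
    show "prob_space \<mu>"
      unfolding \<mu>_def by (rule M.prob_space_distr[OF \<Phi>_meas])
    show "sets \<mu> = sets borel"
      by (simp add: \<mu>_def)
    have "{x \<in> space borel. x \<in> E} \<in> sets borel"
      using compact_imp_closed[OF \<open>compact E\<close>] by simp
    then show "AE x in \<mu>. x \<in> E"
      using AE_C unfolding \<mu>_def by (subst AE_distr_iff[OF \<Phi>_meas]) (auto simp: C_def)
    show "strict_mono r" by fact
    fix f :: "'a \<Rightarrow> complex" assume f: "continuous_on UNIV f"
    \<comment> \<open>Weak convergence tests bounded functions; \<open>f\<close> is bounded along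
      the curve because the curve has bounded range.\<close>
    have "compact (closure (range \<Phi>))"
      using \<Phi>(2) by simp
    then have "bounded (f ` closure (range \<Phi>))"
      by (intro compact_imp_bounded compact_continuous_image continuous_on_subset[OF f]) auto
    then obtain B where "\<And>x. x \<in> closure (range \<Phi>) \<Longrightarrow> norm (f x) \<le> B"
      by (auto simp: bounded_iff)
    then have "norm (f (\<Phi> t)) \<le> B" for t
      using closure_subset[of "range \<Phi>"] by auto
    moreover have "continuous_on UNIV (\<lambda>t. f (\<Phi> t))"
      by (rule continuous_on_compose2[OF f \<Phi>(1)]) auto
    ultimately have "(\<lambda>n. \<Sum>x\<in>S (r n). u (r n) x *\<^sub>R f (\<Phi> (\<tau> (w (r n) x)))) \<longlonglongrightarrow> (\<integral>t. f (\<Phi> t) \<partial>M)"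
      by (intro lim)
    also have "(\<integral>t. f (\<Phi> t) \<partial>M) = (\<integral>x. f x \<partial>\<mu>)"
      unfolding \<mu>_def using borel_measurable_continuous_onI[OF f] \<Phi>_meas by (simp add: integral_distr)
    also have "(\<lambda>n. \<Sum>x\<in>S (r n). u (r n) x *\<^sub>R f (\<Phi> (\<tau> (w (r n) x)))) =
        (\<lambda>n. \<Sum>x\<in>S (r n). u (r n) x *\<^sub>R f (w (r n) x))"
      by (intro ext sum.cong refl) (simp only: \<tau>(2)[OF w])
    finally show "(\<lambda>n. \<Sum>x\<in>S (r n). u (r n) x *\<^sub>R f (w (r n) x)) \<longlonglongrightarrow> (\<integral>x. f x \<partial>\<mu>)" .
  qed
qed

subsection \<open>Energy and moments\<close>

lemma norm_word_monom_le: "norm (word_monom z xs) \<le> norm z ^ length xs"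
  by (induction xs) (auto simp: norm_mult intro!: mult_mono Finite_Cartesian_Product.norm_nth_le)

lemma continuous_on_word_monom: "continuous_on S (\<lambda>z. word_monom z xs)"
  by (rule has_derivative_continuous_on) (rule has_derivative_word_monom)

lemma norm_geometric_remainder_le:
  fixes q :: complex
  assumes "norm q \<le> c" "c < 1"
  shows "norm (1 / (1 - q) - (\<Sum>k<L. q ^ k)) \<le> c ^ L / (1 - c)"
proof -
  have "q \<noteq> 1" using assms by auto
  then have "1 / (1 - q) - (\<Sum>k<L. q ^ k) = q ^ L / (1 - q)"
    by (simp add: sum_gp_strict diff_divide_distrib)
  moreover have "norm (q ^ L / (1 - q)) \<le> c ^ L / (1 - c)"
    unfolding norm_divide norm_power
  proof (intro frac_le power_mono assms norm_ge_zero zero_le_power)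
    show "1 - c \<le> norm (1 - q)"
      using norm_triangle_ineq2[of 1 q] assms by simp
  qed (use assms norm_ge_zero[of q] in linarith)+
  ultimately show ?thesis by simp
qed

text \<open>Cutting the geometric series of the kernel at degree \<open>L\<close> makes an error
  that is uniformly small on the sphere. The double integral of the truncation is the sum of the
  squared moments with weights \<open>(r\<^sup>2) ^ length xs\<close>, which are at most 1.\<close>

lemma da_energy_le:
  fixes \<mu> :: "(complex ^ 'n::finite) measure"
  assumes "\<mu> \<in> sphere_prob_measures"
    and moments: "\<And>L. (\<Sum>xs | length xs < L. (norm (\<integral>z. word_monom z xs \<partial>\<mu>))\<^sup>2) \<le> B"
  shows "da_energy \<mu> \<le> ennreal B"
  unfolding da_energy_def
proof (intro SUP_least ennreal_leI)
  fix r :: real assume "r \<in> {0..<1}"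
  then have r: "0 \<le> r" "r < 1" by auto
  have sets: "sets \<mu> = sets (restrict_space borel (sphere 0 1))" and "prob_space \<mu>"
    using assms(1) by (auto simp: sphere_prob_measures_def)
  interpret prob_space \<mu> by fact
  have space: "space \<mu> = sphere 0 1"
    using sets_eq_imp_space_eq[OF sets] by (simp add: space_restrict_space)
  have meas: "f \<in> borel_measurable \<mu>" if "f \<in> borel_measurable borel" for f :: "complex ^ 'n \<Rightarrow> 'b::topological_space"
    using measurable_restrict_space1[OF that] by (simp add: measurable_cong_sets[OF sets refl])
  have int_monom: "integrable \<mu> (\<lambda>z. word_monom z xs)" for xs
  proof (rule integrable_const_bound)
    show "AE z in \<mu>. norm (word_monom z xs) \<le> 1"
      using norm_word_monom_le[where xs = xs] by (intro AE_I2) (metis dist_0_norm mem_sphere power_one space)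
    show "(\<lambda>z. word_monom z xs) \<in> borel_measurable \<mu>"
      by (intro meas borel_measurable_continuous_onI continuous_on_word_monom)
  qed
  define m where "m xs = (\<integral>z. word_monom z xs \<partial>\<mu>)" for xs
  define k where "k z w = Re (da_kernel (r *\<^sub>R z) (r *\<^sub>R w))" for z w :: "complex ^ 'n"
  define S where "S L z w = (\<Sum>xs | length xs < L. of_real ((r\<^sup>2) ^ length xs) * (word_monom z xs * cnj (word_monom w xs)))"
    for L and z w :: "complex ^ 'n"
  define e where "e L = (r\<^sup>2) ^ L / (1 - r\<^sup>2)" for L :: nat
  have r2: "r\<^sup>2 < 1"
    using r by (simp add: power_less_one_iff)
  have S_eq: "S L z w = (\<Sum>k<L. (of_real (r * r) * cinner_vec z w) ^ k)" for L z w
    by (simp add: S_def sum_words_less power_mult_distrib sum_word_monom[symmetric] sum_distrib_left power2_eq_square)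
  have approx: "\<bar>k z w - Re (S L z w)\<bar> \<le> e L" if "z \<in> sphere 0 1" "w \<in> sphere 0 1" for z w L
  proof -
    have "norm (of_real (r * r) * cinner_vec z w) \<le> r\<^sup>2"
      using mult_left_mono[OF norm_cinner_vec_le[of z w], of "r * r"] that
      by (simp add: norm_mult power2_eq_square)
    from norm_geometric_remainder_le[OF this r2, of L]
    have "norm (da_kernel (r *\<^sub>R z) (r *\<^sub>R w) - S L z w) \<le> e L"
      by (simp add: da_kernel_def cinner_vec_scaleR S_eq e_def)
    then show ?thesis
      using abs_Re_le_cmod[of "da_kernel (r *\<^sub>R z) (r *\<^sub>R w) - S L z w"] by (simp add: k_def)
  qed
  have int_S: "integrable \<mu> (S L z)"
    and int_S': "(\<integral>w. S L z w \<partial>\<mu>) = (\<Sum>xs | length xs < L. of_real ((r\<^sup>2) ^ length xs) * cnj (m xs) * word_monom z xs)"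
    for L z
    unfolding S_def by (auto simp: int_monom m_def mult_ac intro!: sum.cong)
  have int_k: "integrable \<mu> (k z)" if "z \<in> sphere 0 1" for z
  proof (rule integrable_const_bound)
    show "AE w in \<mu>. norm (k z w) \<le> e 0"
      \<comment> \<open>Since \<open>S 0\<close> is the empty sum, the error bound
        \<open>e 0\<close> bounds the kernel itself.\<close>
      using approx[OF that, of _ 0] by (intro AE_I2) (auto simp: space S_def)
    have [measurable]: "(\<lambda>w. cnj ((r *\<^sub>R w) $ i)) \<in> borel_measurable borel" for i :: 'n
      by (intro borel_measurable_continuous_onI continuous_intros)
    show "k z \<in> borel_measurable \<mu>"
      unfolding k_def da_kernel_def cinner_vec_def
      by (intro meas) measurable
  qed
  have "(\<integral>z. (\<integral>w. k z w \<partial>\<mu>) \<partial>\<mu>) \<le> B + e L" for L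
  proof (cases "integrable \<mu> (\<lambda>z. \<integral>w. k z w \<partial>\<mu>)")
    case True
    have int_SS: "integrable \<mu> (\<lambda>z. \<integral>w. S L z w \<partial>\<mu>)"
      unfolding int_S' by (intro Bochner_Integration.integrable_sum integrable_mult_right int_monom)
    have "(\<integral>w. k z w \<partial>\<mu>) \<le> Re (\<integral>w. S L z w \<partial>\<mu>) + e L" if "z \<in> sphere 0 1" for z
    proof -
      have "(\<integral>w. k z w \<partial>\<mu>) \<le> (\<integral>w. Re (S L z w) + e L \<partial>\<mu>)"
      proof (rule integral_mono[OF int_k[OF that]])
        show "integrable \<mu> (\<lambda>w. Re (S L z w) + e L)"
          using int_S by auto
        show "k z w \<le> Re (S L z w) + e L" if "w \<in> space \<mu>" for w
          using approx[OF \<open>z \<in> sphere 0 1\<close>, of w L] that by (simp add: space)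
      qed
      then show ?thesis
        using int_S[of L z] by (simp add: prob_space)
    qed
    then have "(\<integral>z. (\<integral>w. k z w \<partial>\<mu>) \<partial>\<mu>) \<le> (\<integral>z. Re (\<integral>w. S L z w \<partial>\<mu>) + e L \<partial>\<mu>)"
      using int_SS by (intro integral_mono[OF True]) (auto simp: space)
    also have "\<dots> = Re (\<integral>z. (\<integral>w. S L z w \<partial>\<mu>) \<partial>\<mu>) + e L"
      using int_SS by (simp add: prob_space)
    also have "(\<integral>z. (\<integral>w. S L z w \<partial>\<mu>) \<partial>\<mu>) = (\<Sum>xs | length xs < L. of_real ((r\<^sup>2) ^ length xs) * cnj (m xs) * m xs)"
      unfolding int_S' by (simp add: int_monom m_def)
    also have "\<dots> = of_real (\<Sum>xs | length xs < L. (r\<^sup>2) ^ length xs * (norm (m xs))\<^sup>2)"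
      by (simp only: of_real_sum of_real_mult complex_norm_square mult.assoc mult.commute[of "cnj _"])
    also have "Re \<dots> \<le> (\<Sum>xs | length xs < L. 1 * (norm (m xs))\<^sup>2)"
      unfolding Re_complex_of_real using r by (intro sum_mono mult_right_mono power_le_one) auto
    also have "\<dots> \<le> B"
      using moments[of L] by (simp add: m_def)
    finally show ?thesis by simp
  next
    case False
    \<comment> \<open>A non-integrable function has Bochner integral 0, so nonnegativity of the
      bound suffices; the empty sum of moments supplies it.\<close>
    have "0 \<le> B" using moments[of 0] by simp
    then show ?thesis
      using r2 by (simp add: not_integrable_integral_eq[OF False] e_def)
  qed
  moreover have "(\<lambda>L. B + e L) \<longlonglongrightarrow> B + 0"
    unfolding e_def using r2 by (intro tendsto_intros tendsto_divide_zero LIMSEQ_power_zero) auto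
  ultimately have "(\<integral>z. (\<integral>w. k z w \<partial>\<mu>) \<partial>\<mu>) \<le> B"
    using LIMSEQ_le_const[of "\<lambda>L. B + e L" B] by auto
  then show "(\<integral>z. (\<integral>w. Re (da_kernel (r *\<^sub>R z) (r *\<^sub>R w)) \<partial>\<mu>) \<partial>\<mu>) \<le> B"
    by (simp add: k_def)
qed

text \<open>Otherwise, for radii tending to 1, there are hull elements of squared norm at most
  \<open>B\<close>. Their coordinates are powers of the radius times conjugated moments of discrete
  measures on \<open>E\<close>, so finite sums of squared moments of a weak limit are also at most
  \<open>B\<close>. The limit then has finite energy, against capacity zero.\<close>

lemma da_cap_zero_norm_hull:
  fixes E :: "(complex ^ 'n::finite) set"
  assumes E: "E \<subseteq> sphere 0 1" "compact E" and cap: "da_cap E = 0"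
  obtains r where "0 < r" "r < 1"
    "\<And>g. g \<in> convex hull ((\<lambda>w. da_vec (r *\<^sub>R w)) ` E) \<Longrightarrow> (norm g)\<^sup>2 > B"
proof (rule ccontr)
  assume contra: "\<not> thesis"
  note hull = that
  \<comment> \<open>The shift by 2 makes the first radius 1/2, so that all radii are
    positive.\<close>
  define r where "r n = 1 - inverse (real (n + 2))" for n
  have r: "0 < r n" "r n < 1" for n
    by (auto simp: r_def field_simps)
  define Q where "Q n S u \<longleftrightarrow> finite S \<and> S \<subseteq> (\<lambda>w. da_vec (r n *\<^sub>R w)) ` E \<and> (\<forall>x\<in>S. 0 \<le> u x) \<and>
      sum u S = 1 \<and> (norm (\<Sum>v\<in>S. u v *\<^sub>R v))\<^sup>2 \<le> B" for n S u
  have "\<exists>S u. Q n S u" for n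
  proof -
    obtain g where g: "g \<in> convex hull ((\<lambda>w. da_vec (r n *\<^sub>R w)) ` E)" "(norm g)\<^sup>2 \<le> B"
      using contra hull[OF r] by (meson not_less)
    from g(1) obtain S u where "finite S" "S \<subseteq> (\<lambda>w. da_vec (r n *\<^sub>R w)) ` E" "\<forall>x\<in>S. 0 \<le> u x"
      "sum u S = 1" "(\<Sum>v\<in>S. u v *\<^sub>R v) = g"
      unfolding convex_hull_explicit by blast
    with g(2) have "Q n S u"
      by (simp add: Q_def)
    then show ?thesis
      by blast
  qed
  then obtain S u where "\<And>n. Q n (S n) (u n)"
    by metis
  then have S: "\<And>n. finite (S n)" "\<And>n. S n \<subseteq> (\<lambda>w. da_vec (r n *\<^sub>R w)) ` E"
    and u: "\<And>n x. x \<in> S n \<Longrightarrow> 0 \<le> u n x" "\<And>n. sum (u n) (S n) = 1"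
    and norm: "\<And>n. (norm (\<Sum>v\<in>S n. u n v *\<^sub>R v))\<^sup>2 \<le> B"
    unfolding Q_def by auto
  \<comment> \<open>One point of \<open>E\<close> is chosen for each vector, so that the convex
    weights become point masses on \<open>E\<close>.\<close>
  define w where "w n x = (SOME w. w \<in> E \<and> x = da_vec (r n *\<^sub>R w))" for n x
  have w: "w n x \<in> E" "x = da_vec (r n *\<^sub>R w n x)" if "x \<in> S n" for n x
    using someI_ex[of "\<lambda>w. w \<in> E \<and> x = da_vec (r n *\<^sub>R w)"] S(2)[of n] that
    unfolding w_def by blast+
  have "E \<subseteq> cball 0 1" using E(1) by auto
  obtain \<mu> s where \<mu>: "prob_space \<mu>" "sets \<mu> = sets borel" "AE x in \<mu>. x \<in> E"
    and s: "strict_mono (s :: nat \<Rightarrow> nat)"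
    and lim: "\<And>f :: complex ^ 'n \<Rightarrow> complex. continuous_on UNIV f \<Longrightarrow>
      (\<lambda>n. \<Sum>x\<in>S (s n). u (s n) x *\<^sub>R f (w (s n) x)) \<longlonglongrightarrow> (\<integral>x. f x \<partial>\<mu>)"
  proof (rule convex_weights_weak_limit[of E S w u, OF E(2) \<open>E \<subseteq> cball 0 1\<close> S(1) w(1) u])
    fix \<mu> :: "(complex ^ 'n) measure" and s :: "nat \<Rightarrow> nat"
    assume "prob_space \<mu>" "sets \<mu> = sets borel" "AE x in \<mu>. x \<in> E" "strict_mono s"
      "\<And>f :: complex ^ 'n \<Rightarrow> complex. continuous_on UNIV f \<Longrightarrow>
        (\<lambda>n. \<Sum>x\<in>S (s n). u (s n) x *\<^sub>R f (w (s n) x)) \<longlonglongrightarrow> (\<integral>x. f x \<partial>\<mu>)"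
    then show thesis
      by (rule that)
  qed
  interpret prob_space \<mu> by fact
  \<comment> \<open>The weak limit lives on the whole space, whereas the capacity ranges over
    measures on the sphere.\<close>
  define \<mu>' where "\<mu>' = restrict_space \<mu> (sphere 0 1)"
  have sphere: "sphere 0 1 \<in> sets \<mu>" "sphere 0 1 \<inter> space \<mu> \<in> sets \<mu>"
    using \<mu>(2) sets_eq_imp_space_eq[OF \<mu>(2)] by auto
  have AE_sphere: "AE x in \<mu>. x \<in> sphere 0 1"
    using \<mu>(3) by eventually_elim (use E(1) in auto)
  then have "emeasure \<mu> (sphere 0 1) = 1"
    using emeasure_eq_1_AE[OF sphere(1)] by simp
  then have \<mu>': "\<mu>' \<in> sphere_prob_measures"
    using prob_space_restrict_space[OF sphere(1)] \<mu>(2)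
    by (simp add: sphere_prob_measures_def \<mu>'_def sets_restrict_space)
  have \<mu>'_E: "AE x in \<mu>'. x \<in> E"
    unfolding \<mu>'_def AE_restrict_space_iff[OF sphere(2)] using \<mu>(3) by eventually_elim simp
  have "da_energy \<mu>' \<le> ennreal B"
  proof (rule da_energy_le[OF \<mu>'])
    fix L
    define g where "g n = (\<Sum>v\<in>S n. u n v *\<^sub>R v)" for n
    have moment: "(\<integral>z. word_monom z xs \<partial>\<mu>') = (\<integral>z. word_monom z xs \<partial>\<mu>)" for xs
    proof -
      have "(\<integral>z. word_monom z xs \<partial>\<mu>') = (\<integral>z. indicator (sphere 0 1) z *\<^sub>R word_monom z xs \<partial>\<mu>)"
        unfolding \<mu>'_def by (rule integral_restrict_space[OF sphere(2)])
      also have "\<dots> = (\<integral>z. word_monom z xs \<partial>\<mu>)"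
      proof (rule integral_cong_AE)
        show meas: "(\<lambda>z. word_monom z xs) \<in> borel_measurable \<mu>"
          using borel_measurable_continuous_onI[OF continuous_on_word_monom] measurable_cong_sets[OF \<mu>(2) refl] by blast
        then show "(\<lambda>z. indicator (sphere 0 1) z *\<^sub>R word_monom z xs) \<in> borel_measurable \<mu>"
          using sphere(1) by measurable
        show "AE z in \<mu>. indicator (sphere 0 1) z *\<^sub>R word_monom z xs = word_monom z xs"
          using AE_sphere by eventually_elim simp
      qed
      finally show ?thesis .
    qed
    have coord: "coord (g n) xs = of_real (r n) ^ length xs * cnj (\<Sum>x\<in>S n. u n x *\<^sub>R word_monom (w n x) xs)" for n xs
    proof -
      have "coord v xs = of_real (r n) ^ length xs * cnj (word_monom (w n v) xs)" if "v \<in> S n" for v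
      proof -
        have "norm (w n v) = 1"
          using w(1)[OF that] E(1) by auto
        then have "norm (r n *\<^sub>R w n v) < 1"
          using r[of n] by simp
        then have "coord (da_vec (r n *\<^sub>R w n v)) xs = of_real (r n) ^ length xs * cnj (word_monom (w n v) xs)"
          by (simp add: word_monom_scaleR)
        then show ?thesis
          using w(2)[OF that] by simp
      qed
      then show ?thesis
        by (simp add: g_def sum_distrib_left scaleR_conv_of_real[where 'a = complex] mult_ac)
    qed
    have "r \<longlonglongrightarrow> 1"
      unfolding r_def by real_asymp
    then have r_lim: "(\<lambda>n. r (s n)) \<longlonglongrightarrow> 1"
      using LIMSEQ_subseq_LIMSEQ[OF _ s] by (simp add: o_def)
    have "(\<lambda>n. coord (g (s n)) xs) \<longlonglongrightarrow> of_real 1 ^ length xs * cnj (\<integral>z. word_monom z xs \<partial>\<mu>)" for xs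
      unfolding coord by (intro tendsto_intros r_lim lim continuous_on_word_monom)
    then have "(\<lambda>n. \<Sum>xs | length xs < L. (norm (coord (g (s n)) xs))\<^sup>2) \<longlonglongrightarrow>
        (\<Sum>xs | length xs < L. (norm (of_real 1 ^ length xs * cnj (\<integral>z. word_monom z xs \<partial>\<mu>)))\<^sup>2)"
      by (intro tendsto_intros)
    moreover have "(\<Sum>xs | length xs < L. (norm (coord (g (s n)) xs))\<^sup>2) \<le> B" for n
      by (rule order_trans[OF sum_coord_le_norm norm[folded g_def]]) simp
    ultimately show "(\<Sum>xs | length xs < L. (norm (\<integral>z. word_monom z xs \<partial>\<mu>'))\<^sup>2) \<le> B"
      unfolding moment by (intro LIMSEQ_le_const2[of "\<lambda>n. \<Sum>xs | length xs < L. (norm (coord (g (s n)) xs))\<^sup>2"]) auto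
  qed
  \<comment> \<open>In \<open>ennreal\<close> the reciprocal of any value below infinity is
    positive, including that of 0.\<close>
  then have "0 < 1 / da_energy \<mu>'"
    by (simp add: ennreal_zero_less_divide le_less_trans)
  also have "1 / da_energy \<mu>' \<le> da_cap E"
    unfolding da_cap_def using \<mu>' \<mu>'_E by (intro SUP_upper) auto
  finally show False
    using cap by simp
qed

subsection \<open>Functions that are large on the set\<close>

instance l2 :: (type) banach ..

text \<open>The denominator has positive real part, and taking reciprocals preserves this.\<close>

lemma Re_da_kernel_pos:
  assumes "norm z < 1" "norm w \<le> 1"
  shows "0 < Re (da_kernel z w)"
  using norm_cinner_vec_less_1[OF assms] complex_Re_le_cmod[of "cinner_vec z w"]
  by (simp add: da_kernel_def Re_complex_div_gt_0)

lemma norm_da_vec: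
  assumes "norm w < 1"
  shows "(norm (da_vec w))\<^sup>2 = 1 / (1 - (norm w)\<^sup>2)"
proof -
  have "complex_of_real ((norm (da_vec w))\<^sup>2) = of_real (1 / (1 - (norm w)\<^sup>2))"
    unfolding cip_self[symmetric] cip_da_vec_da_vec[OF assms assms] da_kernel_def cinner_vec_self by simp
  then show ?thesis
    by (simp only: of_real_eq_iff)
qed

text \<open>
  A first-order variation argument; approximate minimisers are enough, so that no minimising
  measure is needed.
\<close>

lemma convex_near_minimal_inner:
  fixes G :: "'a::real_inner set"
  assumes "convex G" "G \<noteq> {}" and bound: "\<And>g. g \<in> G \<Longrightarrow> norm g \<le> c"
    and "B > 0" and B: "\<And>g. g \<in> G \<Longrightarrow> (norm g)\<^sup>2 > B"
  obtains g where "g \<in> G" "\<And>k. k \<in> G \<Longrightarrow> inner g k > (norm g)\<^sup>2 / 2"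
proof -
  define D where "D = (2 * c)\<^sup>2"
  \<comment> \<open>The step length also fixes the permitted defect \<open>t\<^sup>2\<close> from
    the infimum. After division by \<open>t\<close>, defect and quadratic term together cost
    \<open>t * (1 + D)\<close>, which has to stay below \<open>B\<close>.\<close>
  define t where "t = min (1 / 2) (B / (2 * (1 + D)))"
  have "D \<ge> 0" by (simp add: D_def)
  have t: "0 < t" "t \<le> 1" "t * (1 + D) < B"
  proof -
    show "0 < t" "t \<le> 1"
      using \<open>B > 0\<close> \<open>D \<ge> 0\<close> by (auto simp: t_def)
    have "t * (1 + D) \<le> B / (2 * (1 + D)) * (1 + D)"
      using \<open>D \<ge> 0\<close> by (intro mult_right_mono) (auto simp: t_def)
    also have "\<dots> = B / 2"
      using \<open>D \<ge> 0\<close> by (simp add: field_simps)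
    finally show "t * (1 + D) < B"
      using \<open>B > 0\<close> by simp
  qed
  define a where "a = (INF g\<in>G. (norm g)\<^sup>2)"
  have bdd: "bdd_below ((\<lambda>g. (norm g)\<^sup>2) ` G)"
    by (auto intro!: bdd_belowI[of _ 0])
  have a_le: "a \<le> (norm g)\<^sup>2" if "g \<in> G" for g
    unfolding a_def using bdd that by (rule cINF_lower)
  have "\<exists>g\<in>G. (norm g)\<^sup>2 < a + t\<^sup>2"
    using cInf_lessD[of "(\<lambda>g. (norm g)\<^sup>2) ` G" "a + t\<^sup>2"] \<open>G \<noteq> {}\<close> t(1) by (auto simp: a_def)
  then obtain g where g: "g \<in> G" "(norm g)\<^sup>2 < a + t\<^sup>2" by blast
  have "inner g k > (norm g)\<^sup>2 / 2" if "k \<in> G" for k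
  proof -
    have "norm (k - g) \<le> 2 * c"
      using norm_triangle_ineq4[of k g] bound[OF that] bound[OF g(1)] by linarith
    then have "(norm (k - g))\<^sup>2 \<le> D"
      unfolding D_def by (intro power_mono) auto
    then have D: "t\<^sup>2 * (norm (k - g))\<^sup>2 \<le> t\<^sup>2 * D"
      by (intro mult_left_mono) auto
    \<comment> \<open>Moving from \<open>g\<close> towards \<open>k\<close> stays in
      \<open>G\<close>, so the squared norm cannot fall below the infimum \<open>a\<close>;
      expanding it bounds \<open>inner g (k - g)\<close> from below.\<close>
    have "(1 - t) *\<^sub>R g + t *\<^sub>R k \<in> G"
      using convexD[OF \<open>convex G\<close> g(1) that, of "1 - t" t] t by simp
    from a_le[OF this] have "a \<le> (norm (g + t *\<^sub>R (k - g)))\<^sup>2"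
      by (simp add: algebra_simps)
    also have "(norm (g + t *\<^sub>R d))\<^sup>2 = (norm g)\<^sup>2 + 2 * t * inner g d + t\<^sup>2 * (norm d)\<^sup>2" for d
      unfolding power2_norm_eq_inner
      by (simp add: inner_add_left inner_add_right inner_commute[of d g] power2_eq_square algebra_simps)
    finally have "0 < t\<^sup>2 + 2 * t * inner g (k - g) + t\<^sup>2 * D"
      using g(2) D by linarith
    also have "\<dots> = t * (t * (1 + D) + 2 * inner g (k - g))"
      by (simp add: power2_eq_square algebra_simps)
    finally have "0 < t * (1 + D) + 2 * inner g (k - g)"
      using t(1) by (simp add: zero_less_mult_iff)
    then have "2 * (norm g)\<^sup>2 - B < 2 * inner g k"
      using t(3) by (simp add: inner_diff_right power2_norm_eq_inner)
    then show ?thesis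
      using B[OF g(1)] by linarith
  qed
  with g(1) show thesis by (rule that)
qed

text \<open>As functions, \<open>h\<close> is the dilation of \<open>g\<close> by \<open>r\<close>.
  This multiplies the coordinate at \<open>xs\<close> by \<open>r ^ length xs\<close>, so the norm
  does not grow, and it moves the values of \<open>g\<close> on the sphere of radius
  \<open>r\<close> to the boundary.\<close>

lemma da_cap_zero_large_on:
  fixes E :: "(complex ^ 'n::finite) set"
  assumes E: "E \<subseteq> sphere 0 1" "compact E" "E \<noteq> {}" and cap: "da_cap E = 0" and "\<epsilon> > 0"
  obtains f where "f \<in> feature_span da_vec (ball 0 1 :: (complex ^ 'n) set)" "norm f \<le> \<epsilon>"
    "\<And>z. norm z < 1 \<Longrightarrow> 0 \<le> Re (cip f (da_vec z))"
    "\<And>\<zeta>. \<zeta> \<in> E \<Longrightarrow> \<forall>\<^sub>F s in at_left 1. 1 \<le> Re (cip f (da_vec (s *\<^sub>R \<zeta>)))"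
proof -
  \<comment> \<open>This threshold yields \<open>2 / norm g < \<epsilon>\<close>, and the left side
    bounds the norm of the final \<open>f\<close>.\<close>
  obtain r where r: "0 < r" "r < 1"
    and hull: "\<And>g. g \<in> convex hull ((\<lambda>w. da_vec (r *\<^sub>R w)) ` E) \<Longrightarrow> (norm g)\<^sup>2 > (2 / \<epsilon>)\<^sup>2"
    using da_cap_zero_norm_hull[OF E(1,2) cap] by blast
  define G where "G = convex hull ((\<lambda>w. da_vec (r *\<^sub>R w)) ` E)"
  define c where "c = sqrt (1 / (1 - r\<^sup>2))"
  have unit: "norm w = 1" if "w \<in> E" for w
    using that E(1) by auto
  have r_ball: "norm (r *\<^sub>R w) < 1" "norm (r\<^sup>2 *\<^sub>R w) < 1" "norm (r\<^sup>2 *\<^sub>R w) \<le> 1" if "w \<in> E" for w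
    using r unit[OF that] by (auto simp: power_less_one_iff power_le_one)
  have "norm (da_vec (r *\<^sub>R w)) = c" if "w \<in> E" for w
    using norm_da_vec[OF r_ball(1)[OF that]] unit[OF that] r
    by (simp add: c_def real_sqrt_unique)
  then have "G \<subseteq> cball 0 c"
    unfolding G_def by (intro hull_minimal convex_cball) auto
  then have bound: "norm g \<le> c" if "g \<in> G" for g
    using that by auto
  have "convex G" "G \<noteq> {}" and kG: "\<And>w. w \<in> E \<Longrightarrow> da_vec (r *\<^sub>R w) \<in> G"
    using E(3) by (auto simp: G_def intro: hull_inc)
  moreover have "(2 / \<epsilon>)\<^sup>2 > 0"
    using \<open>\<epsilon> > 0\<close> by simp
  ultimately obtain g where g: "g \<in> G" "\<And>k. k \<in> G \<Longrightarrow> inner g k > (norm g)\<^sup>2 / 2"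
    using convex_near_minimal_inner[of G c "(2 / \<epsilon>)\<^sup>2"] bound hull unfolding G_def by blast
  have norm_g: "2 / \<epsilon> < norm g"
    using hull[OF g(1)[unfolded G_def]] by (rule power_less_imp_less_base) simp
  then have "norm g > 0"
    using \<open>\<epsilon> > 0\<close> by (meson divide_pos_pos less_trans zero_less_numeral)
  obtain S u where S: "finite S" "S \<subseteq> (\<lambda>w. da_vec (r *\<^sub>R w)) ` E" "\<And>v. v \<in> S \<Longrightarrow> 0 \<le> u v"
    and g_eq: "g = (\<Sum>v\<in>S. u v *\<^sub>R v)"
    using g(1) unfolding G_def convex_hull_explicit by blast
  define w where "w v = (SOME w. w \<in> E \<and> v = da_vec (r *\<^sub>R w))" for v
  have w: "w v \<in> E" "v = da_vec (r *\<^sub>R w v)" if "v \<in> S" for v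
    using someI_ex[of "\<lambda>w. w \<in> E \<and> v = da_vec (r *\<^sub>R w)"] S(2) that
    unfolding w_def by blast+
  define h where "h = (\<Sum>v\<in>S. u v *\<^sub>R da_vec (r\<^sup>2 *\<^sub>R w v))"
  define f where "f = (2 / (norm g)\<^sup>2) *\<^sub>R h"
  have "norm h \<le> norm g"
  proof (rule norm_l2_mono)
    fix xs
    define m where "m = (\<Sum>v\<in>S. u v *\<^sub>R cnj (word_monom (w v) xs))"
    have "coord v xs = of_real (r ^ length xs) * cnj (word_monom (w v) xs)" if "v \<in> S" for v
      by (subst w(2)[OF that], subst coord_da_vec[OF r_ball(1)[OF w(1)[OF that]]])
         (simp add: word_monom_scaleR)
    then have "coord g xs = of_real (r ^ length xs) * m"
      by (simp add: g_eq m_def sum_distrib_left scaleR_conv_of_real[where 'a = complex] mult_ac)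
    moreover have "coord (da_vec (r\<^sup>2 *\<^sub>R w v)) xs = of_real ((r\<^sup>2) ^ length xs) * cnj (word_monom (w v) xs)" if "v \<in> S" for v
      by (subst coord_da_vec[OF r_ball(2)[OF w(1)[OF that]]]) (simp add: word_monom_scaleR)
    then have "coord h xs = of_real ((r\<^sup>2) ^ length xs) * m"
      by (simp add: h_def m_def sum_distrib_left scaleR_conv_of_real[where 'a = complex] mult_ac)
    moreover have "(r\<^sup>2) ^ length xs \<le> r ^ length xs"
      using r by (intro power_mono) (auto simp: power2_eq_square mult_left_le_one_le)
    ultimately show "norm (coord h xs) \<le> norm (coord g xs)"
      using r by (simp add: norm_mult norm_power mult_right_mono)
  qed
  have cip_h: "cip h (da_vec z) = (\<Sum>v\<in>S. of_real (u v) * da_kernel z (r\<^sup>2 *\<^sub>R w v))" if "norm z < 1" for z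
    unfolding h_def cip_sum_left cip_scaleR_left
    using that r_ball(2) w(1) by (intro sum.cong refl) (simp only: cip_da_vec_da_vec)
  have cip_f: "Re (cip f z) = 2 / (norm g)\<^sup>2 * Re (cip h z)" for z
    by (simp add: f_def cip_scaleR_left)
  show thesis
  proof (rule that)
    show "f \<in> feature_span da_vec (ball 0 1)"
      unfolding f_def h_def using r_ball(2) w(1)
      by (intro feature_span_scaleR feature_span_sum feature_span_mem) auto
    have "norm f \<le> 2 / (norm g)\<^sup>2 * norm g"
      unfolding f_def using \<open>norm h \<le> norm g\<close> by (simp add: divide_right_mono)
    also have "\<dots> = 2 / norm g"
      by (simp add: power2_eq_square)
    also have "\<dots> \<le> \<epsilon>"
      using norm_g \<open>\<epsilon> > 0\<close> \<open>norm g > 0\<close> by (simp add: field_simps)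
    finally show "norm f \<le> \<epsilon>" .
    show "0 \<le> Re (cip f (da_vec z))" if "norm z < 1" for z
      unfolding cip_f cip_h[OF that] Re_sum using Re_da_kernel_pos[OF that r_ball(3)[OF w(1)]] S(3)
      by (auto intro!: mult_nonneg_nonneg sum_nonneg divide_nonneg_nonneg simp: less_imp_le)
    show "\<forall>\<^sub>F s in at_left 1. 1 \<le> Re (cip f (da_vec (s *\<^sub>R \<zeta>)))" if "\<zeta> \<in> E" for \<zeta>
    proof -
      have "\<forall>\<^sub>F s in at_left 1. s \<in> {0<..<1::real}"
        by (rule eventually_at_left_real) simp
      \<comment> \<open>At \<open>s = 1\<close> the vector \<open>da_vec \<zeta>\<close> is
        unspecified; the limit is therefore taken in an explicit formula that is continuous
        there.\<close>
      then have ev: "\<forall>\<^sub>F s in at_left 1. (\<Sum>v\<in>S. of_real (u v) * (1 / (1 - of_real (s * r\<^sup>2) * cinner_vec \<zeta> (w v)))) =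
          cip h (da_vec (s *\<^sub>R \<zeta>))"
      proof eventually_elim
        case (elim s)
        then have "norm (s *\<^sub>R \<zeta>) < 1"
          using unit[OF that] by simp
        then show ?case
          by (simp only: cip_h da_kernel_def cinner_vec_scaleR)
      qed
      have "1 - of_real (1 * r\<^sup>2) * cinner_vec \<zeta> (w v) \<noteq> 0" if "v \<in> S" for v
      proof -
        have "norm (r\<^sup>2 *\<^sub>R w v) < 1"
          by (rule r_ball(2)[OF w(1)[OF that]])
        \<comment> \<open>The arguments are swapped because the strict bound needs its first
          argument inside the open ball, and here \<open>\<zeta>\<close> is on the sphere.\<close>
        then have "norm (cinner_vec (r\<^sup>2 *\<^sub>R w v) \<zeta>) < 1"
          using unit[OF \<open>\<zeta> \<in> E\<close>] by (intro norm_cinner_vec_less_1) auto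
        moreover have "norm (cinner_vec (r\<^sup>2 *\<^sub>R w v) \<zeta>) = norm (of_real (1 * r\<^sup>2) * cinner_vec \<zeta> (w v))"
        proof -
          have "cinner_vec (w v) \<zeta> = cnj (cinner_vec \<zeta> (w v))"
            by (simp add: cinner_vec_def mult.commute)
          then show ?thesis
            using cinner_vec_scaleR[of "r\<^sup>2" "w v" 1 \<zeta>] by (simp add: norm_mult)
        qed
        ultimately show ?thesis
          by auto
      qed
      then have "((\<lambda>s. \<Sum>v\<in>S. of_real (u v) * (1 / (1 - of_real (s * r\<^sup>2) * cinner_vec \<zeta> (w v)))) \<longlongrightarrow>
          (\<Sum>v\<in>S. of_real (u v) * (1 / (1 - of_real (1 * r\<^sup>2) * cinner_vec \<zeta> (w v))))) (at_left 1)"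
        by (intro tendsto_intros) auto
      also have "(\<Sum>v\<in>S. of_real (u v) * (1 / (1 - of_real (1 * r\<^sup>2) * cinner_vec \<zeta> (w v)))) =
          cip g (da_vec (r *\<^sub>R \<zeta>))"
      proof -
        have "cip v (da_vec (r *\<^sub>R \<zeta>)) = 1 / (1 - of_real (1 * r\<^sup>2) * cinner_vec \<zeta> (w v))" if "v \<in> S" for v
          by (subst w(2)[OF that], subst cip_da_vec_da_vec[OF r_ball(1)[OF \<open>\<zeta> \<in> E\<close>] r_ball(1)[OF w(1)[OF that]]])
             (simp add: da_kernel_def cinner_vec_scaleR power2_eq_square)
        then show ?thesis
          by (simp add: g_eq cip_sum_left cip_scaleR_left)
      qed
      finally have "((\<lambda>s. cip h (da_vec (s *\<^sub>R \<zeta>))) \<longlongrightarrow> cip g (da_vec (r *\<^sub>R \<zeta>))) (at_left 1)"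
        by (rule Lim_transform_eventually[OF _ ev])
      then have "((\<lambda>s. Re (cip f (da_vec (s *\<^sub>R \<zeta>)))) \<longlongrightarrow> 2 / (norm g)\<^sup>2 * inner g (da_vec (r *\<^sub>R \<zeta>))) (at_left 1)"
        unfolding cip_f Re_cip[symmetric] by (intro tendsto_intros)
      \<comment> \<open>Near-minimality of \<open>g\<close>, tested against the feature vector at
        \<open>r *\<^sub>R \<zeta>\<close>, is exactly what this normalisation was made for.\<close>
      moreover have "1 < 2 / (norm g)\<^sup>2 * inner g (da_vec (r *\<^sub>R \<zeta>))"
        using g(2)[OF kG[OF that]] \<open>norm g > 0\<close> by (simp add: field_simps)
      ultimately have "\<forall>\<^sub>F s in at_left 1. 1 < Re (cip f (da_vec (s *\<^sub>R \<zeta>)))"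
        by (rule order_tendstoD(1))
      then show ?thesis
        by eventually_elim simp
    qed
  qed
qed

section \<open>Summation of the large functions\<close>

theorem theorem1p2:
  fixes E :: "(complex ^ 'n) set"
  assumes "E \<subseteq> sphere 0 1"
    and "compact E"
    and "da_cap E = 0"
  shows "\<exists>f \<in> drury_arveson. \<forall>\<zeta>\<in>E.
    filterlim (\<lambda>r::real. norm (f (r *\<^sub>R \<zeta>))) at_top (at_left 1)"
proof (cases "E = {}")
  \<comment> \<open>For empty \<open>E\<close> there are no kernel vectors to combine, and the zero
    function serves.\<close>
  case True
  then show ?thesis
    using feature_fun_in_drury_arveson[OF feature_span_zero] by blast
next
  case False
  define M where "M = feature_span da_vec (ball 0 1 :: (complex ^ 'n) set)"
  define Q where "Q n f \<longleftrightarrow> f \<in> M \<and> norm f \<le> (1 / 2) ^ n \<and>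
      (\<forall>z. norm z < 1 \<longrightarrow> 0 \<le> Re (cip f (da_vec z))) \<and>
      (\<forall>\<zeta>\<in>E. \<forall>\<^sub>F s in at_left 1. 1 \<le> Re (cip f (da_vec (s *\<^sub>R \<zeta>))))" for n :: nat and f
  have "\<exists>f. Q n f" for n
  proof -
    have "0 < (1 / 2 :: real) ^ n" by simp
    from assms(1,2) False assms(3) this show ?thesis
    proof (rule da_cap_zero_large_on)
      fix f assume "f \<in> feature_span da_vec (ball 0 1 :: (complex ^ 'n) set)" "norm f \<le> (1 / 2) ^ n"
        "\<And>z. norm z < 1 \<Longrightarrow> 0 \<le> Re (cip f (da_vec z))"
        "\<And>\<zeta>. \<zeta> \<in> E \<Longrightarrow> \<forall>\<^sub>F s in at_left 1. 1 \<le> Re (cip f (da_vec (s *\<^sub>R \<zeta>)))"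
      then have "Q n f"
        by (simp add: Q_def M_def)
      then show ?thesis ..
    qed
  qed
  then have "\<exists>f. \<forall>n. Q n (f n)"
    by (intro choice allI)
  then obtain f where "\<forall>n. Q n (f n)" ..
  then have f: "\<And>n. f n \<in> M" "\<And>n. norm (f n) \<le> (1 / 2) ^ n"
    and pos: "\<And>n z. norm z < 1 \<Longrightarrow> 0 \<le> Re (cip (f n) (da_vec z))"
    and large: "\<And>n \<zeta>. \<zeta> \<in> E \<Longrightarrow> \<forall>\<^sub>F s in at_left 1. 1 \<le> Re (cip (f n) (da_vec (s *\<^sub>R \<zeta>)))"
    by (auto simp: Q_def)
  have "summable f"
    by (rule summable_comparison_test'[OF summable_geometric[of "1 / 2 :: real"], of 0]) (use f(2) in auto)
  then have sums: "f sums suminf f"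
    by (rule summable_sums)
  define F where "F = suminf f"
  have "(\<lambda>n. \<Sum>i<n. f i) \<longlonglongrightarrow> F"
    using sums by (simp add: sums_def F_def)
  then have "F \<in> M"
    using f(1) unfolding M_def by (rule feature_span_limit[rotated, OF _ feature_span_sum])
  have "filterlim (\<lambda>r. norm (feature_fun da_vec (ball 0 1) F (r *\<^sub>R \<zeta>))) at_top (at_left 1)" if "\<zeta> \<in> E" for \<zeta>
    unfolding filterlim_at_top
  proof
    fix Z :: real
    obtain N :: nat where N: "Z \<le> real N"
      using real_arch_simple by blast
    have "\<forall>\<^sub>F s in at_left 1. s \<in> {0<..<1::real}"
      by (rule eventually_at_left_real) simp
    \<comment> \<open>Finitely many terms are simultaneously at least 1 near the boundary. The real
      parts of all other terms are nonnegative, so the tail cannot cancel this contribution.\<close>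
    moreover have "\<forall>\<^sub>F s in at_left 1. \<forall>n\<in>{..<N}. 1 \<le> Re (cip (f n) (da_vec (s *\<^sub>R \<zeta>)))"
      by (rule eventually_ball_finite) (auto intro: large[OF that])
    ultimately show "\<forall>\<^sub>F s in at_left 1. Z \<le> norm (feature_fun da_vec (ball 0 1) F (s *\<^sub>R \<zeta>))"
    proof eventually_elim
      case (elim s)
      have s: "norm (s *\<^sub>R \<zeta>) < 1"
        using elim(1) that assms(1) by auto
      have re: "(\<lambda>n. Re (cip (f n) (da_vec (s *\<^sub>R \<zeta>)))) sums Re (cip F (da_vec (s *\<^sub>R \<zeta>)))"
        unfolding F_def by (intro sums_Re bounded_linear.sums[OF bounded_linear_cip_left sums])
      have "real N \<le> (\<Sum>n<N. Re (cip (f n) (da_vec (s *\<^sub>R \<zeta>))))"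
        using sum_mono[of "{..<N}" "\<lambda>_. 1 :: real"] elim(2) by simp
      also have "\<dots> \<le> Re (cip F (da_vec (s *\<^sub>R \<zeta>)))"
        using sum_le_suminf[OF sums_summable[OF re], of "{..<N}"] pos[OF s] sums_unique[OF re] by simp
      also have "\<dots> \<le> norm (cip F (da_vec (s *\<^sub>R \<zeta>)))"
        by (rule complex_Re_le_cmod)
      finally show ?case
        using N s by (simp add: feature_fun_def)
    qed
  qed
  moreover have "feature_fun da_vec (ball 0 1) F \<in> drury_arveson"
    using \<open>F \<in> M\<close> unfolding M_def by (rule feature_fun_in_drury_arveson)
  ultimately show ?thesis
    by blast
qed

end
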